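(* Consider the BGK equation $\partial_tf+v\cdot\nabla_xf=\frac{\tau_f}{\varepsilon}(M[f]-f)$ and the positivity-preserving IMEX scheme $$f^{(i)} = f^n - \Delta t\sum_{j=1}^{i-1}\tilde a_{ij}\,v\cdot\nabla_xf^{(j)} + \Delta t\sum_{j=1}^i a_{ij}\frac{\tau_{f^{(j)}}}{\varepsilon}(M[f^{(j)}]-f^{(j)}),\quad i=1,\dots,\nu,$$ $$f^{n+1}=f^{(\nu)}+\alpha\Delta t^2\frac{\tau_{f^*}}{\varepsilon^2}(M[f^{n+1}]-f^{n+1}),$$ where $f^*$ is $f^n$, any $f^{(i)}$, or $f^{n+1}$. If the scheme is of type A and GSA, it is asymptotic-preserving: for fixed $\Delta t$, in the limit $\varepsilon\to0$, the scheme becomes a second-order explicit Runge-Kutta scheme applied to the limiting compressible Euler system $$\partial_t\rho+\nabla_x\cdot(\rho u)=0,\quad \partial_t(\rho u)+\nabla_x\cdot(\rho u\otimes u+pI)=0,\quad \partial_tE+\nabla_x\cdot((E+p)u)=0,$$ with $p=\rho T$ and $E=\frac{d_v}2\rho T+\frac12\rho|u|^2$.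
   Context: **BGK notation.** $f=f(t,x,v)$, $x\in\Omega\subset\mathbb R^{d_x}$, $v\in\mathbb R^{d_v}$, $\varepsilon>0$ is the Knudsen number, $$M[f]=\frac{\rho}{(2\pi T)^{d_v/2}}\exp\Big(-\frac{|v-u|^2}{2T}\Big),\quad \rho=\int f\,dv,\quad u=\frac1\rho\int fv\,dv,\quad T=\frac1{d_v\rho}\int f|v-u|^2\,dv,$$ and $\tau_f>0$ depends only on $\rho$ and $T$. Write $\phi(v)=(1,v,|v|^2/2)^T$, $\langle g\rangle=\int_{\mathbb R^{d_v}}g\,dv$, and $U=\langle f\phi\rangle=(\rho,\rho u,E)^T$. The Euler system is $\partial_tU+\nabla_x\cdot\langle M[f]\,v\phi\rangle=0$ ($M[f]$ depends only on $U$). **Coefficients.** $\tilde a_{ij}=0$ for $j\ge i$ and $a_{ij}=0$ for $j>i$; $\tilde c_i=\sum_{j<i}\tilde a_{ij}$, $c_i=\sum_{j\le i}a_{ij}$. Type A: the matrix $A=(a_{ij})$ is invertible. GSA (globally stiffly accurate): the weights are $w_i=a_{\nu i}$, $\tilde w_i=\tilde a_{\nu i}$. The coefficients satisfy $\alpha\ge0$ and the order conditions $$\sum_i\tilde w_i=\sum_iw_i=1,\qquad\sum_i\tilde w_i\tilde c_i=\sum_i\tilde w_ic_i=\sum_iw_i\tilde c_i=\sum_iw_ic_i-\alpha=\tfrac12.$$ **Positivity.** The scheme is positivity-preserving, so all $f^{(i)}$ and $f^{n}$ are nonnegative, with positive density and temperature, and each $\tau_{f^{(i)}}$ is positive. **Limit.**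 The limit $\varepsilon\to0$ is understood formally: $\Delta t$ is fixed, the stage values and numerical solutions are assumed to converge (with their $x$-derivatives and moments), with limits having positive density and temperature, and one passes to the limit in the relations defining the scheme and in their moments. The assertion is that the limiting moments $U^n,U^{n+1}$ are related by an explicit Runge-Kutta scheme satisfying the second-order conditions, applied to the Euler system. *)

theory Defs
  imports "Jordan_Normal_Form.Matrix" "HOL-Analysis.Analysis"
begin

no_notation Matrix.vec_index (infixl \<open>$\<close> 100)

text \<open>
  The space dimension is the cardinality of the index type 'n, the velocity dimension that
  of 'm.  An injection emb from 'n to 'm says which velocity component transports along which
  space direction, so that the space dimension is at most the velocity dimension (for equal
  dimensions take the identity).
\<close>

type_synonym ('n, 'm) kinetic = "real^'n \<Rightarrow> real^'m \<Rightarrow> real"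

text \<open>Conserved variables (\<rho>, \<rho>u, E).\<close>

type_synonym 'm state = "real \<times> (real^'m) \<times> real"

definition partial :: "'n::finite \<Rightarrow> (real^'n \<Rightarrow> 'b::real_normed_vector) \<Rightarrow> real^'n \<Rightarrow> 'b" where
  "partial k g x = frechet_derivative g (at x) (axis k 1)"

definition density :: "(real^'m::finite \<Rightarrow> real) \<Rightarrow> real" where
  "density g = (\<integral>v. g v \<partial>lborel)"

definition velocity :: "(real^'m::finite \<Rightarrow> real) \<Rightarrow> real^'m" where
  "velocity g = (1 / density g) *\<^sub>R (\<integral>v. g v *\<^sub>R v \<partial>lborel)"

definition temperature :: "(real^'m::finite \<Rightarrow> real) \<Rightarrow> real" where
  "temperature g =
     1 / (real CARD('m) * density g) * (\<integral>v. g v * (norm (v - velocity g))\<^sup>2 \<partial>lborel)"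

definition maxwellian :: "(real^'m::finite \<Rightarrow> real) \<Rightarrow> real^'m \<Rightarrow> real" where
  "maxwellian g v =
     density g / (2 * pi * temperature g) powr (real CARD('m) / 2)
       * exp (- (norm (v - velocity g))\<^sup>2 / (2 * temperature g))"

definition collision_invariants :: "real^'m::finite \<Rightarrow> 'm state" where
  "collision_invariants v = (1, v, (norm v)\<^sup>2 / 2)"

definition moments :: "(real^'m::finite \<Rightarrow> real) \<Rightarrow> 'm state" where
  "moments g = (\<integral>v. g v *\<^sub>R collision_invariants v \<partial>lborel)"

definition has_moments :: "(real^'m::finite \<Rightarrow> real) \<Rightarrow> bool" where
  "has_moments g \<longleftrightarrow> integrable lborel (\<lambda>v. g v *\<^sub>R collision_invariants v)"

definition transport :: "('n::finite \<Rightarrow> 'm::finite) \<Rightarrow> ('n, 'm) kinetic \<Rightarrow> ('n, 'm) kinetic" where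
  "transport emb f x v = (\<Sum>k\<in>UNIV. v $ emb k * partial k (\<lambda>y. f y v) x)"

text \<open>
  What is needed for all terms of the scheme, and for their moments, to be meaningful on the
  space domain \<Omega>, together with positivity.
\<close>

definition admissible_kinetic ::
    "('n::finite \<Rightarrow> 'm::finite) \<Rightarrow> (real^'n) set \<Rightarrow> ('n, 'm) kinetic \<Rightarrow> bool" where
  "admissible_kinetic emb \<Omega> f \<longleftrightarrow>
     (\<forall>x\<in>\<Omega>.
        (\<forall>v. f x v \<ge> 0) \<and>
        (\<forall>v. (\<lambda>y. f y v) differentiable (at x)) \<and>
        has_moments (f x) \<and>
        has_moments (transport emb f x) \<and>
        density (f x) > 0 \<and>
        temperature (f x) > 0)"

text \<open>
  Arguments of \<open>imex_step\<close>: \<open>aE\<close>, \<open>aI\<close> are the explicit (tilde) and implicit coefficients;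
  the relaxation rate \<tau> is a function of density and temperature; \<open>f\<close> is the family of stages,
  indexed from 1 to \<nu>.
\<close>

definition imex_step ::
    "('n::finite \<Rightarrow> 'm::finite) \<Rightarrow> (real^'n) set \<Rightarrow> (real \<Rightarrow> real \<Rightarrow> real) \<Rightarrow>
     nat \<Rightarrow> (nat \<Rightarrow> nat \<Rightarrow> real) \<Rightarrow> (nat \<Rightarrow> nat \<Rightarrow> real) \<Rightarrow> real \<Rightarrow> real \<Rightarrow> real \<Rightarrow>
     ('n, 'm) kinetic \<Rightarrow> (nat \<Rightarrow> ('n, 'm) kinetic) \<Rightarrow> ('n, 'm) kinetic \<Rightarrow> ('n, 'm) kinetic \<Rightarrow> bool"
  where
  "imex_step emb \<Omega> \<tau> \<nu> aE aI \<alpha> \<Delta>t \<epsilon> fn f fstar fn1 \<longleftrightarrow>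
     (\<forall>i\<in>{1..\<nu>}. \<forall>x\<in>\<Omega>. \<forall>v.
        f i x v = fn x v
          - \<Delta>t * (\<Sum>j\<in>{1..<i}. aE i j * transport emb (f j) x v)
          + \<Delta>t * (\<Sum>j\<in>{1..i}. aI i j * (\<tau> (density (f j x)) (temperature (f j x)) / \<epsilon>)
                                     * (maxwellian (f j x) v - f j x v))) \<and>
     (\<forall>x\<in>\<Omega>. \<forall>v.
        fn1 x v = f \<nu> x v
          + \<alpha> * \<Delta>t\<^sup>2 * (\<tau> (density (fstar x)) (temperature (fstar x)) / \<epsilon>\<^sup>2)
              * (maxwellian (fn1 x) v - fn1 x v))"

definition kinetic_converges ::
    "('n::finite \<Rightarrow> 'm::finite) \<Rightarrow> (real^'n) set \<Rightarrow>
     (real \<Rightarrow> ('n, 'm) kinetic) \<Rightarrow> ('n, 'm) kinetic \<Rightarrow> bool" where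
  "kinetic_converges emb \<Omega> f g \<longleftrightarrow>
     (\<forall>x\<in>\<Omega>.
        (\<forall>v. ((\<lambda>\<epsilon>. f \<epsilon> x v) \<longlongrightarrow> g x v) (at_right 0)) \<and>
        (\<forall>v k. ((\<lambda>\<epsilon>. partial k (\<lambda>y. f \<epsilon> y v) x) \<longlongrightarrow> partial k (\<lambda>y. g y v) x) (at_right 0)) \<and>
        ((\<lambda>\<epsilon>. moments (f \<epsilon> x)) \<longlongrightarrow> moments (g x)) (at_right 0) \<and>
        ((\<lambda>\<epsilon>. moments (transport emb (f \<epsilon>) x)) \<longlongrightarrow> moments (transport emb g x)) (at_right 0))"

definition imex_coefficients ::
    "nat \<Rightarrow> (nat \<Rightarrow> nat \<Rightarrow> real) \<Rightarrow> (nat \<Rightarrow> nat \<Rightarrow> real) \<Rightarrow> bool" where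
  "imex_coefficients \<nu> aE aI \<longleftrightarrow>
     (\<forall>i\<in>{1..\<nu>}. \<forall>j\<in>{1..\<nu>}. (j \<ge> i \<longrightarrow> aE i j = 0) \<and> (j > i \<longrightarrow> aI i j = 0))"

text \<open>Matrix entries of \<open>mat\<close> are numbered from 0, stages from 1.\<close>

definition type_A :: "nat \<Rightarrow> (nat \<Rightarrow> nat \<Rightarrow> real) \<Rightarrow> bool" where
  "type_A \<nu> aI \<longleftrightarrow> invertible_mat (Matrix.mat \<nu> \<nu> (\<lambda>(i, j). aI (Suc i) (Suc j)))"

definition GSA ::
    "nat \<Rightarrow> (nat \<Rightarrow> nat \<Rightarrow> real) \<Rightarrow> (nat \<Rightarrow> nat \<Rightarrow> real) \<Rightarrow> (nat \<Rightarrow> real) \<Rightarrow> (nat \<Rightarrow> real) \<Rightarrow> bool" where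
  "GSA \<nu> aE aI wE wI \<longleftrightarrow> (\<forall>i\<in>{1..\<nu>}. wE i = aE \<nu> i \<and> wI i = aI \<nu> i)"

definition imex_order_two ::
    "nat \<Rightarrow> (nat \<Rightarrow> nat \<Rightarrow> real) \<Rightarrow> (nat \<Rightarrow> nat \<Rightarrow> real) \<Rightarrow> (nat \<Rightarrow> real) \<Rightarrow> (nat \<Rightarrow> real) \<Rightarrow>
     real \<Rightarrow> bool" where
  "imex_order_two \<nu> aE aI wE wI \<alpha> \<longleftrightarrow>
     (let cE = (\<lambda>i. \<Sum>j\<in>{1..<i}. aE i j); cI = (\<lambda>i. \<Sum>j\<in>{1..i}. aI i j) in
        (\<Sum>i\<in>{1..\<nu>}. wE i) = 1 \<and>
        (\<Sum>i\<in>{1..\<nu>}. wI i) = 1 \<and>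
        (\<Sum>i\<in>{1..\<nu>}. wE i * cE i) = 1/2 \<and>
        (\<Sum>i\<in>{1..\<nu>}. wE i * cI i) = 1/2 \<and>
        (\<Sum>i\<in>{1..\<nu>}. wI i * cE i) = 1/2 \<and>
        (\<Sum>i\<in>{1..\<nu>}. wI i * cI i) - \<alpha> = 1/2)"

fun euler_velocity :: "'m::finite state \<Rightarrow> real^'m" where
  "euler_velocity (\<rho>, m, E) = (1 / \<rho>) *\<^sub>R m"

text \<open>This solves \<open>E = d\<^sub>v/2 \<rho>T + 1/2 \<rho>|u|\<^sup>2\<close> for T, see the lemma below.\<close>

fun euler_temperature :: "'m::finite state \<Rightarrow> real" where
  "euler_temperature (\<rho>, m, E) =
     2 / (real CARD('m) * \<rho>) * (E - \<rho> * (norm (euler_velocity (\<rho>, m, E)))\<^sup>2 / 2)"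

fun euler_pressure :: "'m::finite state \<Rightarrow> real" where
  "euler_pressure (\<rho>, m, E) = \<rho> * euler_temperature (\<rho>, m, E)"

lemma euler_energy:
  fixes m :: "real^'m::finite"
  assumes "\<rho> \<noteq> 0"
  shows "E = real CARD('m) / 2 * \<rho> * euler_temperature (\<rho>, m, E)
             + 1/2 * \<rho> * (norm (euler_velocity (\<rho>, m, E)))\<^sup>2"
  using assms by (simp add: field_simps)

text \<open>Column k of the flux \<open>(\<rho>u, \<rho>u \<otimes> u + pI, (E + p)u)\<close>.\<close>

fun euler_flux :: "'m::finite \<Rightarrow> 'm state \<Rightarrow> 'm state" where
  "euler_flux k (\<rho>, m, E) =
     (let u = euler_velocity (\<rho>, m, E); p = euler_pressure (\<rho>, m, E) in
        (\<rho> * u $ k, (\<rho> * u $ k) *\<^sub>R u + p *\<^sub>R axis k 1, (E + p) * u $ k))"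

text \<open>
  With \<open>euler_divergence emb U\<close> for the space divergence of the flux of the field \<open>U\<close>, the
  Euler system reads \<open>\<partial>\<^sub>t U + euler_divergence emb U = 0\<close>.
\<close>

definition euler_divergence ::
    "('n::finite \<Rightarrow> 'm::finite) \<Rightarrow> (real^'n \<Rightarrow> 'm state) \<Rightarrow> real^'n \<Rightarrow> 'm state" where
  "euler_divergence emb U x = (\<Sum>k\<in>UNIV. partial k (\<lambda>y. euler_flux (emb k) (U y)) x)"

definition admissible_euler :: "(real^'n::finite) set \<Rightarrow> (real^'n \<Rightarrow> 'm::finite state) \<Rightarrow> bool" where
  "admissible_euler \<Omega> U \<longleftrightarrow>
     (\<forall>x\<in>\<Omega>. U differentiable (at x) \<and> fst (U x) > 0 \<and> euler_temperature (U x) > 0)"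

definition explicit_tableau :: "nat \<Rightarrow> (nat \<Rightarrow> nat \<Rightarrow> real) \<Rightarrow> bool" where
  "explicit_tableau s A \<longleftrightarrow> (\<forall>i\<in>{1..s}. \<forall>j\<in>{1..s}. j \<ge> i \<longrightarrow> A i j = 0)"

definition rk_order_two :: "nat \<Rightarrow> (nat \<Rightarrow> nat \<Rightarrow> real) \<Rightarrow> (nat \<Rightarrow> real) \<Rightarrow> bool" where
  "rk_order_two s A b \<longleftrightarrow>
     (\<Sum>i\<in>{1..s}. b i) = 1 \<and>
     (\<Sum>i\<in>{1..s}. b i * (\<Sum>j\<in>{1..s}. A i j)) = 1/2"

definition euler_rk_step ::
    "('n::finite \<Rightarrow> 'm::finite) \<Rightarrow> (real^'n) set \<Rightarrow> nat \<Rightarrow> (nat \<Rightarrow> nat \<Rightarrow> real) \<Rightarrow> (nat \<Rightarrow> real) \<Rightarrow>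
     real \<Rightarrow> (real^'n \<Rightarrow> 'm state) \<Rightarrow> (real^'n \<Rightarrow> 'm state) \<Rightarrow> bool" where
  "euler_rk_step emb \<Omega> s A b \<Delta>t U0 U1 \<longleftrightarrow>
     (\<exists>V :: nat \<Rightarrow> real^'n \<Rightarrow> 'm state.
        (\<forall>i\<in>{1..s}. admissible_euler \<Omega> (V i)) \<and>
        (\<forall>i\<in>{1..s}. \<forall>x\<in>\<Omega>.
           V i x = U0 x - \<Delta>t *\<^sub>R (\<Sum>j\<in>{1..s}. A i j *\<^sub>R euler_divergence emb (V j) x)) \<and>
        (\<forall>x\<in>\<Omega>.
           U1 x = U0 x - \<Delta>t *\<^sub>R (\<Sum>i\<in>{1..s}. b i *\<^sub>R euler_divergence emb (V i) x)))"

end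

theory Submission
  imports Defs "HOL-Probability.Distributions"
begin

text \<open>
  Two facts about the collision term \<open>\<tau> (M[f] - f)\<close> carry the proof. Its moments against the collision
  invariants vanish, so the stiff terms disappear from the moments of every step, for each
  \<open>\<epsilon> > 0\<close> and for the correction with the factor \<open>\<alpha> / \<epsilon>\<^sup>2\<close> as well (\<open>imex_step_moments\<close>,
  \<open>imex_final_moments\<close>). On the other hand the stage equations multiplied by \<open>\<epsilon>\<close> show that the
  implicit matrix annihilates the vector of limiting collision terms; in type A this matrix is
  invertible, and the limiting stages are local Maxwellians (\<open>stages_relax_to_maxwellian\<close>).

  The moments of the limiting stages therefore satisfy the explicit part of the tableau with the
  moments of the transport term of a Maxwellian as right-hand side. These are the divergence of the
  Euler flux (\<open>transport_moments_eq_euler_divergence\<close>): Gaussian integrals give the moments of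
  order up to three, and the divergence is taken out of the integral by dominated convergence. The
  latter rests on the logarithm of a Maxwellian being a quadratic polynomial in \<open>v\<close>. From its values at
  finitely many velocities one recovers density, velocity and temperature, which are therefore
  differentiable in \<open>x\<close> (\<open>maxwellian_field_differentiable\<close>), and differentiability of the
  coefficients at a single point bounds the difference quotients by a polynomial times a Gaussian
  (\<open>exp_quadratic_field_lipschitz\<close>).

  Global stiff accuracy identifies the weights with the last row of the explicit tableau, so the new
  value is the last stage, and the order conditions on \<open>aE\<close> and \<open>wE\<close> are those of second order for
  the explicit scheme.
\<close>

(* The dot denotes the Euclidean inner product throughout. *)
no_notation Matrix.scalar_prod (infix \<open>\<bullet>\<close> 70)

section \<open>The standard Gaussian on a Euclidean space\<close>

definition std_gaussian :: "'a::euclidean_space \<Rightarrow> real" where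
  "std_gaussian w = exp (- (norm w)\<^sup>2 / 2) / (2 * pi) powr (real DIM('a) / 2)"

lemma std_gaussian_nonneg [simp]: "0 \<le> std_gaussian w"
  by (simp add: std_gaussian_def)

lemma std_gaussian_measurable [measurable]: "std_gaussian \<in> borel_measurable borel"
  unfolding std_gaussian_def by measurable

lemma std_gaussian_eq_prod:
  "std_gaussian (w::'a::euclidean_space) = (\<Prod>b\<in>Basis. std_normal_density (w \<bullet> b))"
proof -
  have n: "(norm w)\<^sup>2 = (\<Sum>b\<in>Basis. (w \<bullet> b)\<^sup>2)"
    unfolding power2_norm_eq_inner by (subst euclidean_inner) (simp add: power2_eq_square)
  have "(\<Prod>b\<in>(Basis::'a set). 1 / sqrt (2 * pi)) = (1 / sqrt (2 * pi)) powr real DIM('a)"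
    by (simp add: powr_realpow)
  also have "\<dots> = 1 / (2 * pi) powr (real DIM('a) / 2)"
    by (simp add: powr_divide powr_half_sqrt[symmetric] powr_powr)
  finally have "(\<Prod>b\<in>(Basis::'a set). 1 / sqrt (2 * pi)) = 1 / (2 * pi) powr (real DIM('a) / 2)" .
  moreover have "(\<Prod>b\<in>Basis. exp (- (w \<bullet> b)\<^sup>2 / 2)) = exp (- (norm w)\<^sup>2 / 2)"
    unfolding n by (simp add: exp_sum[symmetric] sum_negf sum_divide_distrib)
  ultimately show ?thesis
    unfolding std_normal_density_def std_gaussian_def by (simp only: prod.distrib) simp
qed

text \<open>
  By Tonelli's theorem nonnegative factors need no prior integrability of their product, so the
  moments of the one-dimensional normal distribution give the even moments of \<open>std_gaussian\<close>.
\<close>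

lemma has_bochner_integral_lborel_prod_nonneg:
  fixes f :: "'a::euclidean_space \<Rightarrow> real \<Rightarrow> real"
  assumes int: "\<And>b. b \<in> Basis \<Longrightarrow> has_bochner_integral lborel (f b) (I b)"
    and nonneg: "\<And>b x. b \<in> Basis \<Longrightarrow> 0 \<le> f b x"
  shows "has_bochner_integral lborel (\<lambda>x. \<Prod>b\<in>Basis. f b (x \<bullet> b)) (\<Prod>b\<in>Basis. I b)"
proof -
  have I: "0 \<le> I b" if "b \<in> Basis" for b
    using Bochner_Integration.integral_nonneg[of lborel "f b"] nonneg[OF that]
      has_bochner_integral_integral_eq[OF int[OF that]] by simp
  have [measurable]: "f b \<in> borel_measurable borel" if "b \<in> Basis" for b
    using borel_measurable_has_bochner_integral[OF int[OF that]] by simp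
  have nn: "(\<integral>\<^sup>+x. f b x \<partial>lborel) = ennreal (I b)" if "b \<in> Basis" for b
    using nn_integral_eq_integral[of lborel "f b"] int[OF that] nonneg[OF that]
    by (simp add: has_bochner_integral_iff)
  have "(\<integral>\<^sup>+x. ennreal (\<Prod>b\<in>Basis. f b (x \<bullet> b)) \<partial>lborel)
      = (\<integral>\<^sup>+x. (\<Prod>b\<in>Basis. ennreal (f b (x \<bullet> b))) \<partial>lborel)"
    by (intro nn_integral_cong) (simp add: prod_ennreal nonneg)
  also have "\<dots> = (\<Prod>b\<in>Basis. (\<integral>\<^sup>+x. f b x \<partial>lborel))"
    by (rule nn_integral_lborel_prod) (auto simp: nonneg)
  also have "\<dots> = (\<Prod>b\<in>Basis. ennreal (I b))"
    using nn by (intro prod.cong) auto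
  also have "\<dots> = ennreal (\<Prod>b\<in>Basis. I b)"
    by (simp add: prod_ennreal I)
  finally show ?thesis
    by (intro has_bochner_integral_nn_integral) (auto intro!: prod_nonneg AE_I2 simp: nonneg I)
qed

lemma has_bochner_integral_std_gaussian:
  "has_bochner_integral lborel (std_gaussian :: 'a::euclidean_space \<Rightarrow> real) 1"
proof -
  have "has_bochner_integral lborel std_normal_density 1"
    using std_normal_moment_even[of 0] by simp
  then have "has_bochner_integral lborel
      (\<lambda>x::'a. \<Prod>b\<in>Basis. std_normal_density (x \<bullet> b)) (\<Prod>b\<in>(Basis::'a set). 1)"
    by (intro has_bochner_integral_lborel_prod_nonneg) auto
  then show ?thesis
    by (simp add: std_gaussian_eq_prod[symmetric])
qed

lemma std_gaussian_second_moment_Basis: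
  assumes i: "i \<in> (Basis :: 'a::euclidean_space set)"
  shows "has_bochner_integral lborel (\<lambda>w::'a. std_gaussian w * (w \<bullet> i)\<^sup>2) 1"
proof -
  let ?h = "\<lambda>b x. std_normal_density x * (if b = i then x\<^sup>2 else 1)"
  have "has_bochner_integral lborel (?h b) 1" for b
    using std_normal_moment_even[of 0] std_normal_moment_even[of 1] by (cases "b = i") auto
  then have "has_bochner_integral lborel (\<lambda>x::'a. \<Prod>b\<in>Basis. ?h b (x \<bullet> b)) (\<Prod>b\<in>(Basis::'a set). 1)"
    by (intro has_bochner_integral_lborel_prod_nonneg) auto
  moreover have "(\<Prod>b\<in>Basis. ?h b (x \<bullet> b)) = std_gaussian x * (x \<bullet> i)\<^sup>2" for x :: 'a
    by (simp add: prod.distrib std_gaussian_eq_prod prod.delta' i)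
  ultimately show ?thesis by simp
qed

text \<open>
  The affine change of variables, used to pass between \<open>std_gaussian\<close> and Gaussians of any centre
  and width.
\<close>

lemma has_bochner_integral_lborel_affine:
  fixes f :: "'a::euclidean_space \<Rightarrow> 'b::{banach, second_countable_topology}"
  assumes f: "has_bochner_integral lborel f I" and c: "c \<noteq> 0"
  shows "has_bochner_integral lborel (\<lambda>x. f (t + c *\<^sub>R x)) ((1 / \<bar>c\<bar> ^ DIM('a)) *\<^sub>R I)"
proof -
  have [measurable]: "f \<in> borel_measurable borel"
    using borel_measurable_has_bochner_integral[OF f] by simp
  have eq: "lborel = Nonnegative_Lebesgue_Integration.density (distr lborel borel (\<lambda>x::'a. t + c *\<^sub>R x)) (\<lambda>_. ennreal (\<bar>c\<bar>^DIM('a)))"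
    using lborel_affine[OF c, of t] by (simp add: ennreal_power)
  have "integrable lborel (\<lambda>x. \<bar>c\<bar>^DIM('a) *\<^sub>R f (t + c *\<^sub>R x))"
    using f unfolding has_bochner_integral_iff
    by (subst (asm) eq) (use c in \<open>simp add: integrable_density integrable_distr_eq\<close>)
  from integrable_scaleR_right[OF this, of "1 / \<bar>c\<bar>^DIM('a)"]
  have int: "integrable lborel (\<lambda>x. f (t + c *\<^sub>R x))"
    using c by simp
  have "I = integral\<^sup>L lborel f"
    using f by (simp add: has_bochner_integral_iff)
  also have "\<dots> = \<bar>c\<bar>^DIM('a) *\<^sub>R (\<integral>x. f (t + c *\<^sub>R x) \<partial>lborel)"
    by (subst eq) (use c in \<open>simp add: integral_density integral_distr\<close>)
  finally show ?thesis
    using int c by (simp add: has_bochner_integral_iff)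
qed

text \<open>
  Changing the signs of some coordinates preserves Lebesgue measure, so the integral of a function
  that changes sign under such a reflection equals its own negative.
\<close>

lemma has_bochner_integral_reflect:
  fixes f :: "'a::euclidean_space \<Rightarrow> 'b::{banach, second_countable_topology}"
  assumes f: "integrable lborel f"
    and sign: "\<And>j. j \<in> Basis \<Longrightarrow> \<bar>c j\<bar> = 1"
    and odd: "\<And>x. f (\<Sum>j\<in>Basis. (c j * (x \<bullet> j)) *\<^sub>R j) = - f x"
  shows "has_bochner_integral lborel f 0"
proof -
  let ?T = "\<lambda>x::'a. \<Sum>j\<in>Basis. (c j * (x \<bullet> j)) *\<^sub>R j"
  have [measurable]: "f \<in> borel_measurable borel"
    using borel_measurable_integrable[OF f] by simp
  have cnz: "c j \<noteq> 0" if "j \<in> Basis" for j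
    using sign[OF that] by auto
  have eq: "lborel = distr lborel borel ?T"
    using lborel_affine_euclidean[of c 0, OF cnz] sign by (simp add: density_1)
  have "integral\<^sup>L lborel f = (\<integral>x. f (?T x) \<partial>lborel)"
    by (subst eq) (simp add: integral_distr)
  also have "\<dots> = - integral\<^sup>L lborel f"
    by (simp add: odd)
  finally have "2 *\<^sub>R integral\<^sup>L lborel f = 0"
    by (simp add: scaleR_2 eq_neg_iff_add_eq_0)
  then show ?thesis
    using f by (simp add: has_bochner_integral_iff)
qed

lemma has_bochner_integral_odd:
  fixes f :: "'a::euclidean_space \<Rightarrow> 'b::{banach, second_countable_topology}"
  assumes f: "integrable lborel f" and odd: "\<And>x. f (- x) = - f x"
  shows "has_bochner_integral lborel f 0"
proof (rule has_bochner_integral_reflect[OF f, of "\<lambda>_. -1"])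
  fix x :: 'a
  have "(\<Sum>j\<in>Basis. (- 1 * (x \<bullet> j)) *\<^sub>R j) = - x"
    by (simp add: sum_negf euclidean_representation)
  then show "f (\<Sum>j\<in>Basis. (- 1 * (x \<bullet> j)) *\<^sub>R j) = - f x"
    using odd by simp
qed auto

text \<open>
  The exponential series gives \<open>(1 + r) ^ p \<le> p! * exp (1 + r)\<close>, which turns the polynomial into
  a linear term of the exponent; completing the square pays for the linear terms with half of the
  quadratic one.
\<close>

lemma polynomial_gaussian_bound:
  fixes b c r :: real
  assumes "c > 0" "r \<ge> 0"
  shows "(1 + r) ^ p * exp (b * r - c * r\<^sup>2)
           \<le> fact p * exp (1 + (b + 1)\<^sup>2 / (2 * c)) * exp (- (c / 2) * r\<^sup>2)"
proof -
  have "(1 + r) ^ p / fact p \<le> exp (1 + r)"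
  proof -
    have "sum (\<lambda>n. (1 + r) ^ n /\<^sub>R fact n) {p} \<le> exp (1 + r)"
      using assms exp_converges[of "1 + r"]
      by (intro sum_le_suminf[THEN order_trans]) (auto simp: sums_iff)
    then show ?thesis by (simp add: divide_inverse mult.commute)
  qed
  then have p: "(1 + r) ^ p \<le> fact p * exp (1 + r)"
    by (simp add: divide_le_eq mult.commute)
  have sq: "(b + 1) * r \<le> (b + 1)\<^sup>2 / (2 * c) + c / 2 * r\<^sup>2"
  proof -
    have "0 \<le> (b + 1 - c * r)\<^sup>2 / (2 * c)"
      using assms by simp
    also have "\<dots> = (b + 1)\<^sup>2 / (2 * c) + c / 2 * r\<^sup>2 - (b + 1) * r"
      using assms by (simp add: field_simps power2_eq_square)
    finally show ?thesis by simp
  qed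
  have "(1 + r) ^ p * exp (b * r - c * r\<^sup>2) \<le> fact p * exp (1 + r) * exp (b * r - c * r\<^sup>2)"
    using p by (intro mult_right_mono) auto
  also have "\<dots> = fact p * exp (1 + (b + 1) * r - c * r\<^sup>2)"
    by (simp add: exp_add[symmetric] algebra_simps)
  also have "\<dots> \<le> fact p * exp (1 + (b + 1)\<^sup>2 / (2 * c) + - (c / 2) * r\<^sup>2)"
    using sq by (intro mult_left_mono) auto
  also have "\<dots> = fact p * exp (1 + (b + 1)\<^sup>2 / (2 * c)) * exp (- (c / 2) * r\<^sup>2)"
    by (simp only: exp_add mult.assoc)
  finally show ?thesis .
qed

lemma integrable_exp_neg_norm_square:
  fixes c :: real
  assumes "c > 0"
  shows "integrable lborel (\<lambda>v::'a::euclidean_space. exp (- c * (norm v)\<^sup>2))"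
proof -
  have "integrable lborel (\<lambda>x::'a. std_gaussian (0 + sqrt (2 * c) *\<^sub>R x) * (2 * pi) powr (real DIM('a) / 2))"
    using has_bochner_integral_lborel_affine[OF has_bochner_integral_std_gaussian, of "sqrt (2 * c)" 0]
      assms by (auto simp: has_bochner_integral_iff)
  then show ?thesis
    using assms by (simp add: std_gaussian_def power_mult_distrib)
qed

lemma integrable_polynomial_gaussian:
  fixes b c :: real
  assumes "c > 0"
  shows "integrable lborel (\<lambda>v::'a::euclidean_space. (1 + norm v) ^ p * exp (b * norm v - c * (norm v)\<^sup>2))"
proof (rule Bochner_Integration.integrable_bound)
  show "integrable lborel (\<lambda>v::'a. fact p * exp (1 + (b + 1)\<^sup>2 / (2 * c)) * exp (- (c / 2) * (norm v)\<^sup>2))"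
    using integrable_exp_neg_norm_square[of "c / 2", where 'a='a] assms
    by (intro integrable_mult_right) auto
  show "AE v::'a in lborel. norm ((1 + norm v) ^ p * exp (b * norm v - c * (norm v)\<^sup>2))
      \<le> norm (fact p * exp (1 + (b + 1)\<^sup>2 / (2 * c)) * exp (- (c / 2) * (norm v)\<^sup>2))"
    using polynomial_gaussian_bound[OF assms, of "norm _"] by (intro AE_I2) (simp add: abs_mult)
qed measurable

lemma integrable_std_gaussian_growth:
  fixes F :: "'a::euclidean_space \<Rightarrow> 'b::{banach, second_countable_topology}"
  assumes [measurable]: "F \<in> borel_measurable borel"
    and growth: "\<And>v. norm (F v) \<le> K * (1 + norm v) ^ p"
  shows "integrable lborel (\<lambda>v. std_gaussian v *\<^sub>R F v)"
proof (rule Bochner_Integration.integrable_bound)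
  show "integrable lborel (\<lambda>v::'a. K / (2 * pi) powr (real DIM('a) / 2) *
      ((1 + norm v) ^ p * exp (0 * norm v - 1 / 2 * (norm v)\<^sup>2)))"
    by (intro integrable_mult_right integrable_polynomial_gaussian) auto
  show "AE v in lborel. norm (std_gaussian v *\<^sub>R F v) \<le> norm (K / (2 * pi) powr (real DIM('a) / 2) *
      ((1 + norm v) ^ p * exp (0 * norm v - 1 / 2 * (norm v)\<^sup>2)))"
  proof (intro AE_I2)
    fix v :: 'a
    have "norm (std_gaussian v *\<^sub>R F v) \<le> std_gaussian v * (K * (1 + norm v) ^ p)"
      using growth[of v] by (simp add: mult_left_mono)
    also have "\<dots> \<le> norm (K / (2 * pi) powr (real DIM('a) / 2) *
      ((1 + norm v) ^ p * exp (0 * norm v - 1 / 2 * (norm v)\<^sup>2)))"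
      unfolding real_norm_def
      by (rule order_trans[OF _ abs_ge_self]) (simp add: std_gaussian_def mult_ac)
    finally show "norm (std_gaussian v *\<^sub>R F v) \<le> norm (K / (2 * pi) powr (real DIM('a) / 2) *
      ((1 + norm v) ^ p * exp (0 * norm v - 1 / 2 * (norm v)\<^sup>2)))" .
  qed
qed measurable

text \<open>
  For \<open>i \<noteq> j\<close> reflecting only the coordinate \<open>i\<close> changes the sign of the integrand.
\<close>

lemma std_gaussian_mixed_moment_Basis:
  assumes i: "i \<in> (Basis :: 'a::euclidean_space set)" and j: "j \<in> Basis"
  shows "has_bochner_integral lborel (\<lambda>w::'a. std_gaussian w * ((w \<bullet> i) * (w \<bullet> j)))
           (if i = j then 1 else 0)"
proof (cases "i = j")
  case True
  then show ?thesis
    using std_gaussian_second_moment_Basis[OF i] by (simp add: power2_eq_square)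
next
  case False
  have "norm ((w \<bullet> i) * (w \<bullet> j)) \<le> 1 * (1 + norm w) ^ 2" for w :: 'a
  proof -
    have "\<bar>w \<bullet> i\<bar> * \<bar>w \<bullet> j\<bar> \<le> (1 + norm w) * (1 + norm w)"
      using Basis_le_norm[OF i, of w] Basis_le_norm[OF j, of w] by (intro mult_mono) auto
    then show ?thesis by (simp add: abs_mult power2_eq_square)
  qed
  then have int: "integrable lborel (\<lambda>w::'a. std_gaussian w *\<^sub>R ((w \<bullet> i) * (w \<bullet> j)))"
    by (intro integrable_std_gaussian_growth[where K = 1 and p = 2]) auto
  \<comment> \<open>The reflection in the hyperplane orthogonal to \<open>i\<close>.\<close>
  let ?c = "\<lambda>b. if b = i then -1 else 1 :: real"
  let ?T = "\<lambda>w::'a. \<Sum>b\<in>Basis. (?c b * (w \<bullet> b)) *\<^sub>R b"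
  have T: "?T w \<bullet> b = ?c b * (w \<bullet> b)" if "b \<in> Basis" for w b
    using that by (rule inner_sum_left_Basis)
  have norm: "norm (?T w) = norm w" for w
  proof -
    have "?T w \<bullet> ?T w = (\<Sum>b\<in>Basis. (?T w \<bullet> b) * (?T w \<bullet> b))"
      by (rule euclidean_inner)
    also have "\<dots> = (\<Sum>b\<in>Basis. (w \<bullet> b) * (w \<bullet> b))"
      by (intro sum.cong) (auto simp: T)
    finally show ?thesis
      by (simp add: norm_eq euclidean_inner[of w w])
  qed
  have "has_bochner_integral lborel (\<lambda>w::'a. std_gaussian w *\<^sub>R ((w \<bullet> i) * (w \<bullet> j))) 0"
    by (rule has_bochner_integral_reflect[OF int, of ?c])
      (use False in \<open>auto simp: T i j std_gaussian_def norm\<close>)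
  then show ?thesis using False by simp
qed

text \<open>
  That the covariance is the identity, in the coordinate-free form that later gives an isotropic
  pressure.
\<close>

lemma std_gaussian_second_moment:
  fixes a b :: "'a::euclidean_space"
  shows "has_bochner_integral lborel (\<lambda>w. std_gaussian w * ((a \<bullet> w) * (b \<bullet> w))) (a \<bullet> b)"
proof -
  have "has_bochner_integral lborel
      (\<lambda>w::'a. \<Sum>i\<in>Basis. \<Sum>j\<in>Basis. (a \<bullet> i) * (b \<bullet> j) * (std_gaussian w * ((w \<bullet> i) * (w \<bullet> j))))
      (\<Sum>i\<in>Basis. \<Sum>j\<in>Basis. (a \<bullet> i) * (b \<bullet> j) * (if i = j then 1 else 0))"
    by (intro has_bochner_integral_sum has_bochner_integral_mult_right std_gaussian_mixed_moment_Basis)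
  moreover have "(\<Sum>i\<in>Basis. \<Sum>j\<in>Basis. (a \<bullet> i) * (b \<bullet> j) * (std_gaussian w * ((w \<bullet> i) * (w \<bullet> j))))
      = std_gaussian w * ((a \<bullet> w) * (b \<bullet> w))" for w
    unfolding euclidean_inner[of a w] euclidean_inner[of b w] sum_product
    by (simp add: sum_distrib_left mult_ac)
  moreover have "(\<Sum>i\<in>Basis. \<Sum>j\<in>Basis. (a \<bullet> i) * (b \<bullet> j) * (if i = j then 1 else 0)) = a \<bullet> b"
    unfolding euclidean_inner[of a b] by (intro sum.cong) (auto simp: if_distrib cong: if_cong)
  ultimately show ?thesis by simp
qed

lemma has_bochner_integral_Pair:
  fixes f :: "'a \<Rightarrow> 'b::{banach, second_countable_topology}"
    and g :: "'a \<Rightarrow> 'c::{banach, second_countable_topology}"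
  assumes f: "has_bochner_integral M f a" and g: "has_bochner_integral M g b"
  shows "has_bochner_integral M (\<lambda>x. (f x, g x)) (a, b)"
proof -
  have "has_bochner_integral M (\<lambda>x. (f x, 0) + (0, g x)) ((a, 0) + (0, b))"
    by (intro has_bochner_integral_add
        has_bochner_integral_bounded_linear[where T = "\<lambda>y. (y, 0)", OF _ f]
        has_bochner_integral_bounded_linear[where T = "\<lambda>y. (0, y)", OF _ g]
        bounded_linear_Pair bounded_linear_ident bounded_linear_zero)
  then show ?thesis by simp
qed

lemma std_gaussian_first_moment:
  "has_bochner_integral lborel (\<lambda>w::'a::euclidean_space. std_gaussian w *\<^sub>R w) 0"
proof (rule has_bochner_integral_odd)
  show "integrable lborel (\<lambda>w::'a. std_gaussian w *\<^sub>R w)"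
    by (rule integrable_std_gaussian_growth[where K = 1 and p = 1]) auto
qed (simp add: std_gaussian_def)

lemma std_gaussian_first_moment_inner:
  "has_bochner_integral lborel (\<lambda>w::'a::euclidean_space. std_gaussian w * (a \<bullet> w)) 0"
  using has_bochner_integral_bounded_linear[OF bounded_linear_inner_right std_gaussian_first_moment, of a]
  by simp

lemma std_gaussian_second_moment_vector:
  fixes a :: "'a::euclidean_space"
  shows "has_bochner_integral lborel (\<lambda>w. std_gaussian w *\<^sub>R ((a \<bullet> w) *\<^sub>R w)) a"
proof -
  have "norm ((a \<bullet> w) *\<^sub>R w) \<le> norm a * (1 + norm w) ^ 2" for w
  proof -
    have "\<bar>a \<bullet> w\<bar> * norm w \<le> (norm a * norm w) * norm w"
      by (intro mult_right_mono Cauchy_Schwarz_ineq2) auto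
    also have "\<dots> \<le> norm a * (1 + norm w) ^ 2"
      by (simp add: mult.assoc power2_eq_square mult_left_mono mult_mono)
    finally show ?thesis by simp
  qed
  then have int: "integrable lborel (\<lambda>w. std_gaussian w *\<^sub>R ((a \<bullet> w) *\<^sub>R w))"
    by (intro integrable_std_gaussian_growth[where K = "norm a" and p = 2]) auto
  have "integral\<^sup>L lborel (\<lambda>w. std_gaussian w *\<^sub>R ((a \<bullet> w) *\<^sub>R w)) = a"
  proof (rule euclidean_eqI)
    fix b :: 'a
    have "integral\<^sup>L lborel (\<lambda>w. std_gaussian w *\<^sub>R ((a \<bullet> w) *\<^sub>R w)) \<bullet> b
        = integral\<^sup>L lborel (\<lambda>w. (std_gaussian w *\<^sub>R ((a \<bullet> w) *\<^sub>R w)) \<bullet> b)"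
      using int by (intro integral_inner_left[symmetric]) auto
    also have "\<dots> = a \<bullet> b"
      using has_bochner_integral_integral_eq[OF std_gaussian_second_moment[of a b]]
      by (simp add: mult.assoc inner_commute)
    finally show "integral\<^sup>L lborel (\<lambda>w. std_gaussian w *\<^sub>R ((a \<bullet> w) *\<^sub>R w)) \<bullet> b = a \<bullet> b" .
  qed
  with int show ?thesis by (simp add: has_bochner_integral_iff)
qed

lemma std_gaussian_norm_moment:
  "has_bochner_integral lborel (\<lambda>w::'a::euclidean_space. std_gaussian w * (norm w)\<^sup>2) (real DIM('a))"
proof -
  have "has_bochner_integral lborel (\<lambda>w::'a. \<Sum>b\<in>Basis. std_gaussian w * ((b \<bullet> w) * (b \<bullet> w)))
      (\<Sum>b\<in>(Basis::'a set). b \<bullet> b)"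
    by (intro has_bochner_integral_sum std_gaussian_second_moment)
  moreover have "(\<Sum>b\<in>(Basis::'a set). b \<bullet> b) = real DIM('a)"
    by simp
  moreover have "(\<Sum>b\<in>Basis. std_gaussian w * ((b \<bullet> w) * (b \<bullet> w))) = std_gaussian w * (norm w)\<^sup>2" for w :: 'a
    unfolding power2_norm_eq_inner euclidean_inner[of w w]
    by (simp add: sum_distrib_left inner_commute)
  ultimately show ?thesis by simp
qed

text \<open>
  This vanishing is the absence of a heat flux in a Maxwellian.
\<close>

lemma std_gaussian_third_moment:
  fixes a :: "'a::euclidean_space"
  shows "has_bochner_integral lborel (\<lambda>w. std_gaussian w * ((a \<bullet> w) * (norm w)\<^sup>2)) 0"
proof (rule has_bochner_integral_odd)
  have "norm ((a \<bullet> w) * (norm w)\<^sup>2) \<le> norm a * (1 + norm w) ^ 3" for w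
  proof -
    have "\<bar>a \<bullet> w\<bar> * (norm w)\<^sup>2 \<le> (norm a * norm w) * (norm w)\<^sup>2"
      by (intro mult_right_mono Cauchy_Schwarz_ineq2) auto
    also have "\<dots> = norm a * (norm w) ^ 3"
      by (simp add: power2_eq_square power3_eq_cube)
    also have "\<dots> \<le> norm a * (1 + norm w) ^ 3"
      by (intro mult_left_mono power_mono) auto
    finally show ?thesis by (simp add: abs_mult)
  qed
  then have "integrable lborel (\<lambda>w. std_gaussian w *\<^sub>R ((a \<bullet> w) * (norm w)\<^sup>2))"
    by (intro integrable_std_gaussian_growth[where K = "norm a" and p = 3]) auto
  then show "integrable lborel (\<lambda>w. std_gaussian w * ((a \<bullet> w) * (norm w)\<^sup>2))"
    by simp
qed (simp add: std_gaussian_def)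

section \<open>Moments and fluxes of Maxwellians\<close>

text \<open>
  The Maxwellian with its density, mean velocity and temperature as free parameters, whereas
  \<open>maxwellian\<close> reads them off from the moments of a distribution function.
\<close>

definition maxwellian_profile :: "real \<Rightarrow> real^'m::finite \<Rightarrow> real \<Rightarrow> real^'m \<Rightarrow> real" where
  "maxwellian_profile \<rho> u T v =
     \<rho> / (2 * pi * T) powr (real CARD('m) / 2) * exp (- (norm (v - u))\<^sup>2 / (2 * T))"

lemma maxwellian_eq_profile:
  "maxwellian g = maxwellian_profile (density g) (velocity g) (temperature g)"
  by (simp add: fun_eq_iff maxwellian_def maxwellian_profile_def)

lemma maxwellian_profile_eq_std_gaussian:
  fixes u v :: "real^'m::finite"
  assumes "T > 0"
  shows "maxwellian_profile \<rho> u T v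
           = \<rho> / sqrt T ^ CARD('m) * std_gaussian ((1 / sqrt T) *\<^sub>R (v - u))"
proof -
  have "(2 * pi * T) powr (real CARD('m) / 2)
      = (2 * pi) powr (real CARD('m) / 2) * T powr (1 / 2 * real CARD('m))"
    using assms by (simp add: powr_mult)
  also have "T powr (1 / 2 * real CARD('m)) = sqrt T ^ CARD('m)"
    using assms by (simp only: powr_powr[symmetric] powr_half_sqrt) (simp add: powr_realpow)
  finally show ?thesis
    using assms by (simp add: maxwellian_profile_def std_gaussian_def power_divide power_mult_distrib mult.commute)
qed

text \<open>
  The substitution \<open>v = u + sqrt T *\<^sub>R w\<close>: its Jacobian cancels the power of \<open>T\<close> in the
  normalisation, and every moment of a Maxwellian becomes one of the standard Gaussian.
\<close>

lemma has_bochner_integral_maxwellian_profile: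
  fixes F :: "real^'m::finite \<Rightarrow> 'b::{banach, second_countable_topology}"
  assumes T: "T > 0"
    and I: "has_bochner_integral lborel (\<lambda>w. std_gaussian w *\<^sub>R F (u + sqrt T *\<^sub>R w)) I"
  shows "has_bochner_integral lborel (\<lambda>v. maxwellian_profile \<rho> u T v *\<^sub>R F v) (\<rho> *\<^sub>R I)"
proof -
  have nz: "sqrt T \<noteq> 0" using T by simp
  have eq: "- (1 / sqrt T) *\<^sub>R u + (1 / sqrt T) *\<^sub>R v = (1 / sqrt T) *\<^sub>R (v - u)" for v
    by (simp add: scaleR_diff_right)
  have eq2: "u + sqrt T *\<^sub>R ((1 / sqrt T) *\<^sub>R (v - u)) = v" for v
    using nz by simp
  have "has_bochner_integral lborel
      (\<lambda>v. std_gaussian ((1 / sqrt T) *\<^sub>R (v - u)) *\<^sub>R F v) (sqrt T ^ CARD('m) *\<^sub>R I)"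
    using has_bochner_integral_lborel_affine[OF I, of "1 / sqrt T" "- (1 / sqrt T) *\<^sub>R u"] T
    unfolding eq eq2 by (simp add: power_divide)
  from has_bochner_integral_scaleR_right[OF this, of "\<rho> / sqrt T ^ CARD('m)"] show ?thesis
    using nz by (simp add: maxwellian_profile_eq_std_gaussian[OF T])
qed

lemma norm_square_shift:
  fixes u w :: "'a::real_inner"
  assumes "T \<ge> 0"
  shows "(norm (u + sqrt T *\<^sub>R w))\<^sup>2 = (norm u)\<^sup>2 + 2 * sqrt T * (u \<bullet> w) + T * (norm w)\<^sup>2"
proof -
  have "sqrt T * (sqrt T * x) = T * x" for x
    using assms by (simp add: mult.assoc[symmetric])
  then show ?thesis
    using assms
    by (simp add: power2_norm_eq_inner algebra_simps inner_add_left inner_add_right inner_commute)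
qed

text \<open>
  In \<open>v = u + sqrt T *\<^sub>R w\<close> the terms linear in \<open>w\<close> vanish, and \<open>|w|\<^sup>2\<close> contributes the dimension,
  hence the thermal part of the energy.
\<close>

lemma maxwellian_profile_moments:
  fixes u :: "real^'m::finite"
  assumes T: "T > 0"
  shows "has_bochner_integral lborel (\<lambda>v. maxwellian_profile \<rho> u T v *\<^sub>R collision_invariants v)
           (\<rho>, \<rho> *\<^sub>R u, real CARD('m) / 2 * \<rho> * T + \<rho> * (norm u)\<^sup>2 / 2)"
proof -
  let ?G = "std_gaussian :: real^'m \<Rightarrow> real"
  have 1: "has_bochner_integral lborel (\<lambda>w. ?G w *\<^sub>R u + sqrt T *\<^sub>R (?G w *\<^sub>R w)) (1 *\<^sub>R u + sqrt T *\<^sub>R 0)"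
    by (intro has_bochner_integral_add has_bochner_integral_scaleR_left has_bochner_integral_scaleR_right
        std_gaussian_first_moment has_bochner_integral_std_gaussian)
  have 2: "has_bochner_integral lborel
      (\<lambda>w. (norm u)\<^sup>2 / 2 * ?G w + sqrt T * (?G w * (u \<bullet> w)) + T / 2 * (?G w * (norm w)\<^sup>2))
      ((norm u)\<^sup>2 / 2 * 1 + sqrt T * 0 + T / 2 * real DIM(real^'m))"
    by (intro has_bochner_integral_add has_bochner_integral_mult_right
        std_gaussian_first_moment_inner has_bochner_integral_std_gaussian std_gaussian_norm_moment)
  have "has_bochner_integral lborel
      (\<lambda>w. ?G w *\<^sub>R (collision_invariants (u + sqrt T *\<^sub>R w)))
      (1, u, (norm u)\<^sup>2 / 2 + T / 2 * real CARD('m))"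
    using has_bochner_integral_Pair[OF has_bochner_integral_std_gaussian
        has_bochner_integral_Pair[OF 1 2]]
    by (rule has_bochner_integral_cong[THEN iffD1, rotated 3])
      (use T in \<open>auto simp: collision_invariants_def norm_square_shift scaleR_add_right field_simps\<close>)
  from has_bochner_integral_maxwellian_profile[OF T this, of \<rho>] show ?thesis
    by (simp add: field_simps)
qed

text \<open>
  This is the closure of the moment hierarchy. Expanding in \<open>w\<close>, only the even terms survive: the
  covariance turns \<open>(a \<bullet> w) w\<close> into the pressure term \<open>T a\<close> and \<open>(a \<bullet> w) (u \<bullet> w)\<close> into the work of
  the pressure, while the cubic term, the heat flux, is zero.
\<close>

lemma maxwellian_profile_flux:
  fixes u a :: "real^'m::finite"
  assumes T: "T > 0"
  shows "has_bochner_integral lborel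
           (\<lambda>v. maxwellian_profile \<rho> u T v *\<^sub>R ((a \<bullet> v) *\<^sub>R collision_invariants v))
           (\<rho> *\<^sub>R (a \<bullet> u, (a \<bullet> u) *\<^sub>R u + T *\<^sub>R a,
             (a \<bullet> u) * ((norm u)\<^sup>2 / 2 + T + real CARD('m) / 2 * T)))"
proof -
  let ?G = "std_gaussian :: real^'m \<Rightarrow> real"
  have s: "sqrt T * sqrt T = T" "sqrt T * (sqrt T * x) = T * x" for x
    using T by (simp_all add: mult.assoc[symmetric])
  have 0: "has_bochner_integral lborel (\<lambda>w. (a \<bullet> u) * ?G w + sqrt T * (?G w * (a \<bullet> w)))
      ((a \<bullet> u) * 1 + sqrt T * 0)"
    by (intro has_bochner_integral_add has_bochner_integral_mult_right
        std_gaussian_first_moment_inner has_bochner_integral_std_gaussian)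
  have 1: "has_bochner_integral lborel (\<lambda>w. ?G w *\<^sub>R ((a \<bullet> u) *\<^sub>R u) + ((a \<bullet> u) * sqrt T) *\<^sub>R (?G w *\<^sub>R w)
        + (?G w * (a \<bullet> w)) *\<^sub>R (sqrt T *\<^sub>R u) + T *\<^sub>R (?G w *\<^sub>R ((a \<bullet> w) *\<^sub>R w)))
      (1 *\<^sub>R ((a \<bullet> u) *\<^sub>R u) + ((a \<bullet> u) * sqrt T) *\<^sub>R 0 + 0 *\<^sub>R (sqrt T *\<^sub>R u) + T *\<^sub>R a)"
    by (intro has_bochner_integral_add has_bochner_integral_scaleR_left has_bochner_integral_scaleR_right
        std_gaussian_first_moment std_gaussian_first_moment_inner has_bochner_integral_std_gaussian
        std_gaussian_second_moment_vector)
  have 2: "has_bochner_integral lborel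
      (\<lambda>w. (a \<bullet> u) * (norm u)\<^sup>2 / 2 * ?G w + (a \<bullet> u) * sqrt T * (?G w * (u \<bullet> w))
        + sqrt T * (norm u)\<^sup>2 / 2 * (?G w * (a \<bullet> w)) + T * (?G w * ((a \<bullet> w) * (u \<bullet> w)))
        + (a \<bullet> u) * T / 2 * (?G w * (norm w)\<^sup>2) + sqrt T * T / 2 * (?G w * ((a \<bullet> w) * (norm w)\<^sup>2)))
      ((a \<bullet> u) * (norm u)\<^sup>2 / 2 * 1 + (a \<bullet> u) * sqrt T * 0
        + sqrt T * (norm u)\<^sup>2 / 2 * 0 + T * (a \<bullet> u)
        + (a \<bullet> u) * T / 2 * real DIM(real^'m) + sqrt T * T / 2 * 0)"
    by (intro has_bochner_integral_add has_bochner_integral_mult_right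
        std_gaussian_first_moment_inner has_bochner_integral_std_gaussian std_gaussian_norm_moment
        std_gaussian_second_moment std_gaussian_third_moment)
  have "has_bochner_integral lborel
      (\<lambda>w. ?G w *\<^sub>R ((a \<bullet> (u + sqrt T *\<^sub>R w)) *\<^sub>R collision_invariants (u + sqrt T *\<^sub>R w)))
      (a \<bullet> u, (a \<bullet> u) *\<^sub>R u + T *\<^sub>R a, (a \<bullet> u) * ((norm u)\<^sup>2 / 2 + T + real CARD('m) / 2 * T))"
    using has_bochner_integral_Pair[OF 0 has_bochner_integral_Pair[OF 1 2]]
    by (rule has_bochner_integral_cong[THEN iffD1, rotated 3])
      (use T in \<open>auto simp: collision_invariants_def norm_square_shift inner_add_right
          scaleR_add_right scaleR_add_left s algebra_simps add_divide_distrib\<close>)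
  from has_bochner_integral_maxwellian_profile[OF T this, of \<rho>] show ?thesis .
qed

lemma euler_flux_eq_maxwellian_flux:
  fixes u :: "real^'m::finite"
  assumes "\<rho> \<noteq> 0"
  shows "euler_flux k (\<rho>, \<rho> *\<^sub>R u, real CARD('m) / 2 * \<rho> * T + \<rho> * (norm u)\<^sup>2 / 2)
           = \<rho> *\<^sub>R (u $ k, (u $ k) *\<^sub>R u + T *\<^sub>R axis k 1,
             (u $ k) * ((norm u)\<^sup>2 / 2 + T + real CARD('m) / 2 * T))"
  using assms by (simp add: Let_def scaleR_add_right field_simps)

lemma has_moments_components:
  fixes h :: "real^'m::finite \<Rightarrow> real"
  assumes "has_moments h"
  shows "integrable lborel h" "integrable lborel (\<lambda>v. h v *\<^sub>R v)" "integrable lborel (\<lambda>v. h v * (norm v)\<^sup>2)"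
    and "moments h = (density h, \<integral>v. h v *\<^sub>R v \<partial>lborel, (\<integral>v. h v * (norm v)\<^sup>2 \<partial>lborel) / 2)"
proof -
  let ?F = "\<lambda>v. h v *\<^sub>R collision_invariants v"
  have F: "has_bochner_integral lborel ?F (moments h)"
    using assms by (simp add: has_moments_def moments_def has_bochner_integral_iff)
  have f1: "has_bochner_integral lborel h (fst (moments h))"
    using has_bochner_integral_bounded_linear[OF bounded_linear_fst F]
    by (simp add: collision_invariants_def)
  have f2: "has_bochner_integral lborel (\<lambda>v. h v *\<^sub>R v) (fst (snd (moments h)))"
    using has_bochner_integral_bounded_linear[OF bounded_linear_fst
        has_bochner_integral_bounded_linear[OF bounded_linear_snd F]]
    by (simp add: collision_invariants_def)
  have "has_bochner_integral lborel (\<lambda>v. 2 * (h v * (norm v)\<^sup>2 / 2)) (2 * snd (snd (moments h)))"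
    using has_bochner_integral_bounded_linear[OF bounded_linear_snd
        has_bochner_integral_bounded_linear[OF bounded_linear_snd F]]
    by (intro has_bochner_integral_mult_right) (simp add: collision_invariants_def)
  then have f3: "has_bochner_integral lborel (\<lambda>v. h v * (norm v)\<^sup>2) (2 * snd (snd (moments h)))"
    by simp
  show "integrable lborel h" "integrable lborel (\<lambda>v. h v *\<^sub>R v)" "integrable lborel (\<lambda>v. h v * (norm v)\<^sup>2)"
    using f1 f2 f3 by (auto simp: has_bochner_integral_iff)
  show "moments h = (density h, \<integral>v. h v *\<^sub>R v \<partial>lborel, (\<integral>v. h v * (norm v)\<^sup>2 \<partial>lborel) / 2)"
    using f1 f2 f3 by (cases "moments h") (auto simp: has_bochner_integral_iff density_def)
qed

text \<open>
  Expanding \<open>|v - u|\<^sup>2\<close> splits the energy into its thermal and kinetic parts.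
\<close>

lemma moments_eq:
  fixes h :: "real^'m::finite \<Rightarrow> real"
  assumes h: "has_moments h" and \<rho>: "density h > 0"
  shows "moments h = (density h, density h *\<^sub>R velocity h,
           real CARD('m) / 2 * density h * temperature h + density h * (norm (velocity h))\<^sup>2 / 2)"
proof -
  let ?u = "velocity h"
  note c = has_moments_components[OF h]
  have m: "(\<integral>v. h v *\<^sub>R v \<partial>lborel) = density h *\<^sub>R ?u"
    using \<rho> by (simp add: velocity_def)
  have "has_bochner_integral lborel h (density h)"
    using c(1) by (simp add: has_bochner_integral_iff density_def)
  moreover have "has_bochner_integral lborel (\<lambda>v. ?u \<bullet> (h v *\<^sub>R v)) (?u \<bullet> (density h *\<^sub>R ?u))"
    using c(2) m
    by (intro has_bochner_integral_bounded_linear[OF bounded_linear_inner_right])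
      (auto simp: has_bochner_integral_iff)
  moreover have "has_bochner_integral lborel (\<lambda>v. h v * (norm v)\<^sup>2) (\<integral>v. h v * (norm v)\<^sup>2 \<partial>lborel)"
    using c(3) by (simp add: has_bochner_integral_iff)
  ultimately have I: "has_bochner_integral lborel
      (\<lambda>v. h v * (norm v)\<^sup>2 - 2 * (?u \<bullet> (h v *\<^sub>R v)) + (norm ?u)\<^sup>2 * h v)
      ((\<integral>v. h v * (norm v)\<^sup>2 \<partial>lborel) - 2 * (?u \<bullet> (density h *\<^sub>R ?u)) + (norm ?u)\<^sup>2 * density h)"
    by (intro has_bochner_integral_add has_bochner_integral_diff has_bochner_integral_mult_right)
  have eq: "h v * (norm v)\<^sup>2 - 2 * (?u \<bullet> (h v *\<^sub>R v)) + (norm ?u)\<^sup>2 * h v = h v * (norm (v - ?u))\<^sup>2" for v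
    by (simp add: power2_norm_eq_inner algebra_simps inner_diff_left inner_diff_right inner_commute)
  have "(\<integral>v. h v * (norm (v - ?u))\<^sup>2 \<partial>lborel)
      = (\<integral>v. h v * (norm v)\<^sup>2 \<partial>lborel) - density h * (norm ?u)\<^sup>2"
    using has_bochner_integral_integral_eq[OF I] unfolding eq
    by (simp add: power2_norm_eq_inner)
  moreover have "(\<integral>v. h v * (norm (v - ?u))\<^sup>2 \<partial>lborel) = real CARD('m) * density h * temperature h"
    using \<rho> by (simp add: temperature_def)
  ultimately show ?thesis
    using c(4) m by (simp add: field_simps)
qed

lemma euler_variables_of_moments:
  fixes h :: "real^'m::finite \<Rightarrow> real"
  assumes "has_moments h" and "density h > 0"
  shows "fst (moments h) = density h" "euler_velocity (moments h) = velocity h"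
    "euler_temperature (moments h) = temperature h"
  using assms by (simp_all add: moments_eq field_simps)

text \<open>
  The collision operator conserves mass, momentum and energy: \<open>maxwellian h\<close> is built from exactly
  the parameters that determine these moments.
\<close>

lemma maxwellian_moments:
  fixes h :: "real^'m::finite \<Rightarrow> real"
  assumes "has_moments h" and "density h > 0" and "temperature h > 0"
  shows "has_moments (maxwellian h)" "moments (maxwellian h) = moments h"
proof -
  have *: "has_bochner_integral lborel (\<lambda>v. maxwellian h v *\<^sub>R collision_invariants v) (moments h)"
    using maxwellian_profile_moments[OF assms(3), of "density h" "velocity h"] assms
    by (simp add: moments_eq maxwellian_eq_profile)
  show "has_moments (maxwellian h)"
    using * by (simp add: has_moments_def has_bochner_integral_iff)
  show "moments (maxwellian h) = moments h"
    using has_bochner_integral_integral_eq[OF *] by (simp add: moments_def[of "maxwellian h"])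
qed

section \<open>Relaxation of the stages to local equilibrium\<close>

text \<open>
  A Maxwellian depends on the distribution only through density, velocity and temperature. These
  are rational functions of the moments that are continuous away from vacuum, so convergence of the
  moments suffices.
\<close>

lemma maxwellian_tendsto:
  fixes h :: "'a \<Rightarrow> real^'m::finite \<Rightarrow> real"
  assumes h: "\<forall>\<^sub>F \<epsilon> in F. has_moments (h \<epsilon>) \<and> density (h \<epsilon>) > 0"
    and g: "has_moments g" "density g > 0" "temperature g > 0"
    and conv: "((\<lambda>\<epsilon>. moments (h \<epsilon>)) \<longlongrightarrow> moments g) F"
  shows "((\<lambda>\<epsilon>. density (h \<epsilon>)) \<longlongrightarrow> density g) F"
    and "((\<lambda>\<epsilon>. temperature (h \<epsilon>)) \<longlongrightarrow> temperature g) F"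
    and "((\<lambda>\<epsilon>. maxwellian (h \<epsilon>) v) \<longlongrightarrow> maxwellian g v) F"
proof -
  obtain \<rho> m E where mg: "moments g = (\<rho>, m, E)" by (cases "moments g")
  have \<rho>: "\<rho> > 0"
    using euler_variables_of_moments(1)[OF g(1,2)] g(2) mg by simp
  have c1: "((\<lambda>\<epsilon>. fst (moments (h \<epsilon>))) \<longlongrightarrow> \<rho>) F"
    and c2: "((\<lambda>\<epsilon>. fst (snd (moments (h \<epsilon>)))) \<longlongrightarrow> m) F"
    and c3: "((\<lambda>\<epsilon>. snd (snd (moments (h \<epsilon>)))) \<longlongrightarrow> E) F"
    using tendsto_fst[OF conv] tendsto_fst[OF tendsto_snd[OF conv]] tendsto_snd[OF tendsto_snd[OF conv]]
    by (simp_all add: mg)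
  have v_eq: "euler_velocity U = (1 / fst U) *\<^sub>R fst (snd U)" for U :: "'m state"
    by (cases U) simp
  have T_eq: "euler_temperature U
      = 2 / (real CARD('m) * fst U) * (snd (snd U) - fst U * (norm (euler_velocity U))\<^sup>2 / 2)"
    for U :: "'m state"
    by (cases U) simp
  have cv: "((\<lambda>\<epsilon>. euler_velocity (moments (h \<epsilon>))) \<longlongrightarrow> euler_velocity (moments g)) F"
    unfolding v_eq using c1 c2 \<rho> by (auto simp: mg intro!: tendsto_intros)
  have cT: "((\<lambda>\<epsilon>. euler_temperature (moments (h \<epsilon>))) \<longlongrightarrow> euler_temperature (moments g)) F"
    unfolding T_eq
    by (intro tendsto_mult tendsto_divide tendsto_diff tendsto_const tendsto_power tendsto_norm cv)
      (use c1 c3 \<rho> in \<open>auto simp: mg\<close>)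
  show d: "((\<lambda>\<epsilon>. density (h \<epsilon>)) \<longlongrightarrow> density g) F"
  proof (rule Lim_transform_eventually)
    show "((\<lambda>\<epsilon>. fst (moments (h \<epsilon>))) \<longlongrightarrow> density g) F"
      using c1 euler_variables_of_moments(1)[OF g(1,2)] mg by simp
    show "\<forall>\<^sub>F \<epsilon> in F. fst (moments (h \<epsilon>)) = density (h \<epsilon>)"
      using h by eventually_elim (simp add: euler_variables_of_moments)
  qed
  have u: "((\<lambda>\<epsilon>. velocity (h \<epsilon>)) \<longlongrightarrow> velocity g) F"
  proof (rule Lim_transform_eventually)
    show "((\<lambda>\<epsilon>. euler_velocity (moments (h \<epsilon>))) \<longlongrightarrow> velocity g) F"
      using cv by (simp add: euler_variables_of_moments[OF g(1,2)])
    show "\<forall>\<^sub>F \<epsilon> in F. euler_velocity (moments (h \<epsilon>)) = velocity (h \<epsilon>)"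
      using h by eventually_elim (simp add: euler_variables_of_moments)
  qed
  show T: "((\<lambda>\<epsilon>. temperature (h \<epsilon>)) \<longlongrightarrow> temperature g) F"
  proof (rule Lim_transform_eventually)
    show "((\<lambda>\<epsilon>. euler_temperature (moments (h \<epsilon>))) \<longlongrightarrow> temperature g) F"
      using cT by (simp add: euler_variables_of_moments[OF g(1,2)])
    show "\<forall>\<^sub>F \<epsilon> in F. euler_temperature (moments (h \<epsilon>)) = temperature (h \<epsilon>)"
      using h by eventually_elim (simp add: euler_variables_of_moments)
  qed
  show "((\<lambda>\<epsilon>. maxwellian (h \<epsilon>) v) \<longlongrightarrow> maxwellian g v) F"
    unfolding maxwellian_def using d u T g by (auto intro!: tendsto_intros)
qed

text \<open>
  Matrix entries are numbered from 0 and stages from 1, hence the shift of indices between the two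
  formulations.
\<close>

lemma type_A_left_inverse:
  assumes "type_A \<nu> aI"
  obtains B where "\<And>k j. k \<in> {1..\<nu>} \<Longrightarrow> j \<in> {1..\<nu>} \<Longrightarrow>
    (\<Sum>i\<in>{1..\<nu>}. B k i * aI i j) = (if k = j then 1 else 0)"
proof -
  let ?A = "Matrix.mat \<nu> \<nu> (\<lambda>(i, j). aI (Suc i) (Suc j))"
  obtain C where C: "C * ?A = 1\<^sub>m (dim_row C)" and AC: "?A * C = 1\<^sub>m \<nu>"
    using assms by (auto simp: type_A_def invertible_mat_def inverts_mat_def)
  have "dim_col (C * ?A) = dim_col (1\<^sub>m (dim_row C) :: real mat)"
    using C by simp
  then have r: "dim_row C = \<nu>" by simp
  have "dim_col (?A * C) = dim_col (1\<^sub>m \<nu> :: real mat)"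
    using AC by simp
  then have c: "dim_col C = \<nu>" by simp
  have idx: "(\<Sum>i\<in>{0..<\<nu>}. C $$ (k, i) * aI (Suc i) (Suc j)) = (if k = j then 1 else 0)"
    if "k < \<nu>" "j < \<nu>" for k j
  proof -
    have "(C * ?A) $$ (k, j) = (if k = j then 1 else 0)"
      using that by (simp add: C r)
    moreover have "(C * ?A) $$ (k, j) = (\<Sum>i\<in>{0..<\<nu>}. C $$ (k, i) * aI (Suc i) (Suc j))"
      using that r c by (auto simp: scalar_prod_def intro!: sum.cong)
    ultimately show ?thesis by simp
  qed
  show ?thesis
  proof (rule that[of "\<lambda>k i. C $$ (k - 1, i - 1)"])
    fix k j assume kj: "k \<in> {1..\<nu>}" "j \<in> {1..\<nu>}"
    have "(\<Sum>i\<in>{1..\<nu>}. C $$ (k - 1, i - 1) * aI i j)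
        = (\<Sum>i\<in>{0..<\<nu>}. C $$ (k - 1, i) * aI (Suc i) (Suc (j - 1)))"
      using kj by (intro sum.reindex_bij_witness[of _ Suc "\<lambda>i. i - 1"]) auto
    also have "\<dots> = (if k = j then 1 else 0)"
      using kj by (subst idx) auto
    finally show "(\<Sum>i\<in>{1..\<nu>}. C $$ (k - 1, i - 1) * aI i j) = (if k = j then 1 else 0)" .
  qed
qed

text \<open>
  Multiplied by \<open>\<epsilon>\<close>, the stage equations say that the implicit matrix, applied to the vector of
  collision terms, is \<open>\<epsilon>\<close> times a convergent quantity. In the limit the matrix maps the vector of
  limiting collision terms to 0, and invertibility forces each of them to vanish; as \<open>\<tau>\<close> is positive,
  the limiting stages are Maxwellians.
\<close>

lemma stages_relax_to_maxwellian:
  fixes emb :: "'n::finite \<Rightarrow> 'm::finite"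
    and f :: "real \<Rightarrow> nat \<Rightarrow> ('n, 'm) kinetic"
  assumes dt: "\<Delta>t > 0"
    and tau_pos: "\<And>\<rho> T. \<rho> > 0 \<Longrightarrow> T > 0 \<Longrightarrow> \<tau> \<rho> T > 0"
    and tau_cont: "continuous_on ({0<..} \<times> {0<..}) (\<lambda>(\<rho>, T). \<tau> \<rho> T)"
    and coeffs: "imex_coefficients \<nu> aE aI"
    and type_A: "type_A \<nu> aI"
    and scheme: "\<And>\<epsilon>. \<epsilon> > 0 \<Longrightarrow>
        imex_step emb \<Omega> \<tau> \<nu> aE aI \<alpha> \<Delta>t \<epsilon> (fn \<epsilon>) (f \<epsilon>) (fstar \<epsilon>) (fn1 \<epsilon>)"
    and adm: "\<And>\<epsilon> i. \<epsilon> > 0 \<Longrightarrow> i \<in> {1..\<nu>} \<Longrightarrow> admissible_kinetic emb \<Omega> (f \<epsilon> i)"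
    and conv_n: "kinetic_converges emb \<Omega> fn gn"
    and conv: "\<And>i. i \<in> {1..\<nu>} \<Longrightarrow> kinetic_converges emb \<Omega> (\<lambda>\<epsilon>. f \<epsilon> i) (g i)"
    and adm_lim: "\<And>i. i \<in> {1..\<nu>} \<Longrightarrow> admissible_kinetic emb \<Omega> (g i)"
    and j: "j \<in> {1..\<nu>}" and x: "x \<in> \<Omega>"
  shows "maxwellian (g j x) = g j x"
proof
  fix v
  define Q where "Q \<epsilon> i = \<tau> (density (f \<epsilon> i x)) (temperature (f \<epsilon> i x))
    * (maxwellian (f \<epsilon> i x) v - f \<epsilon> i x v)" for \<epsilon> i
  define L where "L i = \<tau> (density (g i x)) (temperature (g i x))
    * (maxwellian (g i x) v - g i x v)" for i
  have Q_lim: "((\<lambda>\<epsilon>. Q \<epsilon> i) \<longlongrightarrow> L i) (at_right 0)" if i: "i \<in> {1..\<nu>}" for i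
  proof -
    have ev: "\<forall>\<^sub>F \<epsilon> in at_right 0. has_moments (f \<epsilon> i x) \<and> density (f \<epsilon> i x) > 0"
      and evT: "\<forall>\<^sub>F \<epsilon> in at_right 0. (density (f \<epsilon> i x), temperature (f \<epsilon> i x)) \<in> {0<..} \<times> {0<..}"
      using adm[OF _ i] x eventually_at_right_less[of "0::real"]
      by (auto simp: admissible_kinetic_def elim!: eventually_mono)
    have g: "has_moments (g i x)" "density (g i x) > 0" "temperature (g i x) > 0"
      using adm_lim[OF i] x by (auto simp: admissible_kinetic_def)
    have c: "((\<lambda>\<epsilon>. moments (f \<epsilon> i x)) \<longlongrightarrow> moments (g i x)) (at_right 0)"
      and cv: "((\<lambda>\<epsilon>. f \<epsilon> i x v) \<longlongrightarrow> g i x v) (at_right 0)"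
      using conv[OF i] x by (auto simp: kinetic_converges_def)
    note lims = maxwellian_tendsto[OF ev g c]
    have "((\<lambda>\<epsilon>. (\<lambda>(\<rho>, T). \<tau> \<rho> T) (density (f \<epsilon> i x), temperature (f \<epsilon> i x)))
        \<longlongrightarrow> (\<lambda>(\<rho>, T). \<tau> \<rho> T) (density (g i x), temperature (g i x))) (at_right 0)"
      by (rule continuous_on_tendsto_compose[OF tau_cont tendsto_Pair[OF lims(1,2)] _ evT])
        (use g in auto)
    then show ?thesis
      unfolding Q_def L_def using lims(3) cv by (auto intro!: tendsto_intros)
  qed
  have transport_lim:
    "((\<lambda>\<epsilon>. transport emb (f \<epsilon> i) x v) \<longlongrightarrow> transport emb (g i) x v) (at_right 0)"
    if i: "i \<in> {1..\<nu>}" for i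
    unfolding transport_def using conv[OF i] x
    by (intro tendsto_sum tendsto_mult tendsto_const) (auto simp: kinetic_converges_def)
  have vanish: "(\<Sum>k\<in>{1..\<nu>}. aI i k * L k) = 0" if i: "i \<in> {1..\<nu>}" for i
  proof -
    have tri: "(\<Sum>k\<in>{1..i}. aI i k * h k) = (\<Sum>k\<in>{1..\<nu>}. aI i k * h k)" for h
      using i coeffs by (intro sum.mono_neutral_left) (auto simp: imex_coefficients_def)
    \<comment> \<open>The stage equation times \<open>\<epsilon>\<close>; everything in parentheses has a limit.\<close>
    have eq: "(\<Sum>k\<in>{1..\<nu>}. aI i k * Q \<epsilon> k)
        = \<epsilon> / \<Delta>t * (f \<epsilon> i x v - fn \<epsilon> x v + \<Delta>t * (\<Sum>k\<in>{1..<i}. aE i k * transport emb (f \<epsilon> k) x v))"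
      if e: "\<epsilon> > 0" for \<epsilon>
    proof -
      have "f \<epsilon> i x v = fn \<epsilon> x v
          - \<Delta>t * (\<Sum>k\<in>{1..<i}. aE i k * transport emb (f \<epsilon> k) x v)
          + \<Delta>t * (\<Sum>k\<in>{1..i}. aI i k * (\<tau> (density (f \<epsilon> k x)) (temperature (f \<epsilon> k x)) / \<epsilon>)
                                   * (maxwellian (f \<epsilon> k x) v - f \<epsilon> k x v))"
        using scheme[OF e] i x by (auto simp: imex_step_def)
      also have "(\<Sum>k\<in>{1..i}. aI i k * (\<tau> (density (f \<epsilon> k x)) (temperature (f \<epsilon> k x)) / \<epsilon>)
                                   * (maxwellian (f \<epsilon> k x) v - f \<epsilon> k x v))
          = (\<Sum>k\<in>{1..i}. aI i k * Q \<epsilon> k) / \<epsilon>"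
        unfolding sum_divide_distrib by (intro sum.cong) (simp_all add: Q_def)
      finally show ?thesis
        unfolding tri[symmetric] using e dt by (simp add: field_simps)
    qed
    have "((\<lambda>\<epsilon>. \<epsilon> / \<Delta>t * (f \<epsilon> i x v - fn \<epsilon> x v
            + \<Delta>t * (\<Sum>k\<in>{1..<i}. aE i k * transport emb (f \<epsilon> k) x v)))
        \<longlongrightarrow> 0 / \<Delta>t * (g i x v - gn x v + \<Delta>t * (\<Sum>k\<in>{1..<i}. aE i k * transport emb (g k) x v)))
        (at_right 0)"
      using i dt x conv[OF i] conv_n
      by (intro tendsto_mult tendsto_divide tendsto_add tendsto_diff tendsto_sum tendsto_const
          tendsto_ident_at transport_lim) (auto simp: kinetic_converges_def)
    from this[unfolded div_0 mult_zero_left]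
    have "((\<lambda>\<epsilon>. \<Sum>k\<in>{1..\<nu>}. aI i k * Q \<epsilon> k) \<longlongrightarrow> 0) (at_right 0)"
    proof (rule Lim_transform_eventually)
      show "\<forall>\<^sub>F \<epsilon> in at_right 0. \<epsilon> / \<Delta>t * (f \<epsilon> i x v - fn \<epsilon> x v
          + \<Delta>t * (\<Sum>k\<in>{1..<i}. aE i k * transport emb (f \<epsilon> k) x v))
        = (\<Sum>k\<in>{1..\<nu>}. aI i k * Q \<epsilon> k)"
        using eventually_at_right_less[of "0::real"] by eventually_elim (rule eq[symmetric])
    qed
    moreover have "((\<lambda>\<epsilon>. \<Sum>k\<in>{1..\<nu>}. aI i k * Q \<epsilon> k) \<longlongrightarrow> (\<Sum>k\<in>{1..\<nu>}. aI i k * L k)) (at_right 0)"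
      by (intro tendsto_intros Q_lim)
    ultimately show ?thesis
      by (rule tendsto_unique[OF trivial_limit_at_right_real, rotated])
  qed
  obtain B where B: "\<And>k j. k \<in> {1..\<nu>} \<Longrightarrow> j \<in> {1..\<nu>} \<Longrightarrow>
      (\<Sum>i\<in>{1..\<nu>}. B k i * aI i j) = (if k = j then 1 else 0)"
    using type_A_left_inverse[OF type_A] by blast
  have "L j = (\<Sum>k\<in>{1..\<nu>}. (if j = k then 1 else 0) * L k)"
    using j by (simp add: if_distrib[of "\<lambda>c. c * _"] cong: if_cong)
  also have "\<dots> = (\<Sum>k\<in>{1..\<nu>}. (\<Sum>i\<in>{1..\<nu>}. B j i * aI i k) * L k)"
    by (intro sum.cong refl) (simp only: B[OF j])
  also have "\<dots> = (\<Sum>i\<in>{1..\<nu>}. B j i * (\<Sum>k\<in>{1..\<nu>}. aI i k * L k))"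
    by (simp add: sum_distrib_left sum_distrib_right mult.assoc) (rule sum.swap)
  also have "\<dots> = 0"
    by (intro sum.neutral ballI) (simp only: vanish mult_zero_right)
  finally have "L j = 0" .
  moreover have "\<tau> (density (g j x)) (temperature (g j x)) > 0"
    using adm_lim[OF j] x by (intro tau_pos) (auto simp: admissible_kinetic_def)
  ultimately show "maxwellian (g j x) v = g j x v"
    by (simp add: L_def)
qed

section \<open>Moments of the scheme\<close>

lemma has_bochner_integral_moments:
  "has_moments h \<Longrightarrow> has_bochner_integral lborel (\<lambda>v. h v *\<^sub>R collision_invariants v) (moments h)"
  by (simp add: has_moments_def moments_def has_bochner_integral_iff)

lemma moments_eqI:
  "has_bochner_integral lborel (\<lambda>v. h v *\<^sub>R collision_invariants v) m \<Longrightarrow> moments h = m"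
  by (simp add: moments_def has_bochner_integral_iff)

text \<open>
  For this reason the stiff terms, singular in \<open>\<epsilon>\<close>, leave no trace in the moments of the scheme.
\<close>

lemma collision_moments_vanish:
  assumes "has_moments h" and "density h > 0" and "temperature h > 0"
  shows "has_bochner_integral lborel (\<lambda>v. (maxwellian h v - h v) *\<^sub>R collision_invariants v) 0"
  using has_bochner_integral_diff[OF has_bochner_integral_moments has_bochner_integral_moments,
      OF maxwellian_moments(1)[OF assms] assms(1)]
  by (simp add: scaleR_diff_left maxwellian_moments(2)[OF assms])

lemma imex_step_moments:
  fixes emb :: "'n::finite \<Rightarrow> 'm::finite"
  assumes step: "imex_step emb \<Omega> \<tau> \<nu> aE aI \<alpha> \<Delta>t \<epsilon> fn f fstar fn1"
    and adm_n: "admissible_kinetic emb \<Omega> fn"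
    and adm: "\<And>i. i \<in> {1..\<nu>} \<Longrightarrow> admissible_kinetic emb \<Omega> (f i)"
    and i: "i \<in> {1..\<nu>}" and x: "x \<in> \<Omega>"
  shows "moments (f i x)
           = moments (fn x) - \<Delta>t *\<^sub>R (\<Sum>j\<in>{1..<i}. aE i j *\<^sub>R moments (transport emb (f j) x))"
proof (rule moments_eqI)
  let ?c = "\<lambda>j. aI i j * (\<tau> (density (f j x)) (temperature (f j x)) / \<epsilon>)"
  let ?\<phi> = "collision_invariants :: real^'m \<Rightarrow> _"
  have "has_bochner_integral lborel
      (\<lambda>v. fn x v *\<^sub>R ?\<phi> v
        - \<Delta>t *\<^sub>R (\<Sum>j\<in>{1..<i}. aE i j *\<^sub>R (transport emb (f j) x v *\<^sub>R ?\<phi> v))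
        + \<Delta>t *\<^sub>R (\<Sum>j\<in>{1..i}. ?c j *\<^sub>R ((maxwellian (f j x) v - f j x v) *\<^sub>R ?\<phi> v)))
      (moments (fn x) - \<Delta>t *\<^sub>R (\<Sum>j\<in>{1..<i}. aE i j *\<^sub>R moments (transport emb (f j) x))
        + \<Delta>t *\<^sub>R (\<Sum>j\<in>{1..i}. ?c j *\<^sub>R 0))"
    using adm_n adm i x
    by (intro has_bochner_integral_add has_bochner_integral_diff has_bochner_integral_scaleR_right
        has_bochner_integral_sum has_bochner_integral_moments collision_moments_vanish)
      (auto simp: admissible_kinetic_def)
  moreover have "fn x v *\<^sub>R ?\<phi> v
        - \<Delta>t *\<^sub>R (\<Sum>j\<in>{1..<i}. aE i j *\<^sub>R (transport emb (f j) x v *\<^sub>R ?\<phi> v))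
        + \<Delta>t *\<^sub>R (\<Sum>j\<in>{1..i}. ?c j *\<^sub>R ((maxwellian (f j x) v - f j x v) *\<^sub>R ?\<phi> v))
      = f i x v *\<^sub>R ?\<phi> v" for v
  proof -
    have "f i x v = fn x v - \<Delta>t * (\<Sum>j\<in>{1..<i}. aE i j * transport emb (f j) x v)
          + \<Delta>t * (\<Sum>j\<in>{1..i}. ?c j * (maxwellian (f j x) v - f j x v))"
      using step i x by (auto simp: imex_step_def)
    then show ?thesis
      by (simp only: scaleR_add_left scaleR_diff_left scaleR_sum_left scaleR_scaleR[symmetric])
  qed
  ultimately show "has_bochner_integral lborel (\<lambda>v. f i x v *\<^sub>R ?\<phi> v)
      (moments (fn x) - \<Delta>t *\<^sub>R (\<Sum>j\<in>{1..<i}. aE i j *\<^sub>R moments (transport emb (f j) x)))"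
    by simp
qed

text \<open>
  The correction of order \<open>1 / \<epsilon>\<^sup>2\<close> is a multiple of a collision term, whichever distribution its
  rate is evaluated at.
\<close>

lemma imex_final_moments:
  fixes emb :: "'n::finite \<Rightarrow> 'm::finite"
  assumes step: "imex_step emb \<Omega> \<tau> \<nu> aE aI \<alpha> \<Delta>t \<epsilon> fn f fstar fn1"
    and adm_last: "admissible_kinetic emb \<Omega> (f \<nu>)"
    and adm1: "admissible_kinetic emb \<Omega> fn1"
    and x: "x \<in> \<Omega>"
  shows "moments (fn1 x) = moments (f \<nu> x)"
proof (rule moments_eqI)
  let ?c = "\<alpha> * \<Delta>t\<^sup>2 * (\<tau> (density (fstar x)) (temperature (fstar x)) / \<epsilon>\<^sup>2)"
  let ?\<phi> = "collision_invariants :: real^'m \<Rightarrow> _"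
  have "has_bochner_integral lborel
      (\<lambda>v. f \<nu> x v *\<^sub>R ?\<phi> v + ?c *\<^sub>R ((maxwellian (fn1 x) v - fn1 x v) *\<^sub>R ?\<phi> v))
      (moments (f \<nu> x) + ?c *\<^sub>R 0)"
    using adm_last adm1 x
    by (intro has_bochner_integral_add has_bochner_integral_scaleR_right
        has_bochner_integral_moments collision_moments_vanish)
      (auto simp: admissible_kinetic_def)
  moreover have "f \<nu> x v *\<^sub>R ?\<phi> v + ?c *\<^sub>R ((maxwellian (fn1 x) v - fn1 x v) *\<^sub>R ?\<phi> v)
      = fn1 x v *\<^sub>R ?\<phi> v" for v
  proof -
    have "fn1 x v = f \<nu> x v + ?c * (maxwellian (fn1 x) v - fn1 x v)"
      using step x by (auto simp: imex_step_def)
    from arg_cong[OF this, of "\<lambda>z. z *\<^sub>R ?\<phi> v"] show ?thesis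
      unfolding scaleR_add_left scaleR_scaleR by (rule sym)
  qed
  ultimately show "has_bochner_integral lborel (\<lambda>v. fn1 x v *\<^sub>R ?\<phi> v) (moments (f \<nu> x))"
    by simp
qed

section \<open>The transport moments of a field of Maxwellians\<close>

lemma differentiable_ln:
  fixes f :: "'a::real_normed_vector \<Rightarrow> real"
  assumes "f differentiable (at x)" and "f x > 0"
  shows "(\<lambda>y. ln (f y)) differentiable (at x)"
proof -
  obtain f' where "(f has_derivative f') (at x)"
    using assms(1) by (auto simp: differentiable_def)
  from has_derivative_ln[OF assms(2) this] show ?thesis
    by (auto simp: differentiable_def)
qed

lemma differentiable_exp:
  fixes f :: "'a::real_normed_vector \<Rightarrow> real"
  assumes "f differentiable (at x)"
  shows "(\<lambda>y. exp (f y)) differentiable (at x)"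
proof -
  obtain f' where "(f has_derivative f') (at x)"
    using assms(1) by (auto simp: differentiable_def)
  from has_derivative_exp[OF this] show ?thesis
    by (auto simp: differentiable_def)
qed

lemma differentiable_eq_on_open:
  assumes "f differentiable (at x)" and "open S" and "x \<in> S" and "\<And>y. y \<in> S \<Longrightarrow> f y = g y"
  shows "g differentiable (at x)"
proof -
  obtain f' where "(f has_derivative f') (at x)"
    using assms(1) by (auto simp: differentiable_def)
  from has_derivative_transform_within_open[OF this assms(2-3)] assms(4) show ?thesis
    by (auto simp: differentiable_def)
qed

lemma differentiable_vec:
  fixes f :: "'a::real_normed_vector \<Rightarrow> real^'m::finite"
  assumes "\<And>i. (\<lambda>y. f y $ i) differentiable (at x)"
  shows "f differentiable (at x)"
  unfolding differentiable_componentwise_within[of f]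
  using assms by (auto simp: Basis_vec_def inner_axis)

lemma ln_maxwellian_profile:
  fixes u v :: "real^'m::finite"
  assumes "\<rho> > 0" and "T > 0"
  shows "ln (maxwellian_profile \<rho> u T v)
           = ln \<rho> - real CARD('m) / 2 * ln (2 * pi * T) - (norm (v - u))\<^sup>2 / (2 * T)"
  using assms by (simp add: maxwellian_profile_def ln_mult ln_div ln_powr)

text \<open>
  Differentiability is known only for the values of \<open>g\<close> at fixed velocities, but the logarithm of a
  Maxwellian is a quadratic polynomial in \<open>v\<close>. Finitely many velocities determine its coefficients:
  with a unit vector \<open>a\<close>, the second difference at \<open>- a, 0, a\<close> is \<open>- 1 / T\<close>, the first difference
  along an axis is \<open>2 / T\<close> times a component of \<open>u\<close>, and the value at 0 then gives the density.
\<close>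

lemma maxwellian_field_differentiable:
  fixes g :: "('n::finite, 'm::finite) kinetic"
  assumes \<Omega>: "open \<Omega>" and x: "x \<in> \<Omega>"
    and eq: "\<And>y. y \<in> \<Omega> \<Longrightarrow> maxwellian (g y) = g y"
    and pos: "\<And>y. y \<in> \<Omega> \<Longrightarrow> density (g y) > 0" "\<And>y. y \<in> \<Omega> \<Longrightarrow> temperature (g y) > 0"
    and diff: "\<And>v. (\<lambda>y. g y v) differentiable (at x)"
  shows "(\<lambda>y. density (g y)) differentiable (at x)"
    and "(\<lambda>y. velocity (g y)) differentiable (at x)"
    and "(\<lambda>y. temperature (g y)) differentiable (at x)"
proof -
  define q where "q v y = ln (g y v)" for v y
  have q: "q v y = ln (density (g y)) - real CARD('m) / 2 * ln (2 * pi * temperature (g y))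
      - (v \<bullet> v - 2 * (v \<bullet> velocity (g y)) + velocity (g y) \<bullet> velocity (g y)) / (2 * temperature (g y))"
    if "y \<in> \<Omega>" for v y
  proof -
    have "q v y = ln (maxwellian (g y) v)"
      by (simp add: q_def eq[OF that])
    moreover have "(norm (v - velocity (g y)))\<^sup>2
        = v \<bullet> v - 2 * (v \<bullet> velocity (g y)) + velocity (g y) \<bullet> velocity (g y)"
      by (simp add: power2_norm_eq_inner inner_diff_left inner_diff_right inner_commute)
    ultimately show ?thesis
      unfolding maxwellian_eq_profile by (simp only: ln_maxwellian_profile[OF pos[OF that]])
  qed
  have gpos: "g y v > 0" if "y \<in> \<Omega>" for y v
  proof -
    have "maxwellian (g y) v > 0"
      using pos[OF that] by (simp add: maxwellian_def)
    then show ?thesis by (simp add: eq[OF that])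
  qed
  have qd: "q v differentiable (at x)" for v
    using differentiable_ln[OF diff gpos[OF x]] by (simp add: q_def[abs_def])
  have eqT: "- 1 / (q a y + q (- a) y - 2 * q 0 y) = temperature (g y)"
    if "y \<in> \<Omega>" "norm a = 1" for a y
  proof -
    have "q a y + q (- a) y - 2 * q 0 y = - 1 / temperature (g y)"
      using pos(2)[OF that(1)] that(2)
      by (simp add: q[OF that(1)] norm_eq_1 field_simps)
    then show ?thesis using pos(2)[OF that(1)] by simp
  qed
  have nz: "q a x + q (- a) x - 2 * q 0 x \<noteq> 0" if "norm a = 1" for a
    using eqT[OF x that] pos(2)[OF x] by force
  have eqv: "temperature (g y) / 2 * (q (axis k 1) y - q (- axis k 1) y) = velocity (g y) $ k"
    if "y \<in> \<Omega>" for k y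
    using pos(2)[OF that]
    by (simp add: q[OF that] inner_axis' field_simps)
  have eqd: "g y 0 * exp (real CARD('m) / 2 * ln (2 * pi * temperature (g y))
      + velocity (g y) \<bullet> velocity (g y) / (2 * temperature (g y))) = density (g y)"
    if "y \<in> \<Omega>" for y
  proof -
    have "g y 0 = exp (q 0 y)"
      using gpos[OF that] by (simp add: q_def)
    then show ?thesis
      using pos[OF that] by (simp add: exp_add[symmetric] q[OF that])
  qed
  obtain a :: "real^'m" where a: "norm a = 1"
    using vector_choose_size[of 1] by auto
  have "(\<lambda>y. - 1 / (q a y + q (- a) y - 2 * q 0 y)) differentiable (at x)"
    by (intro differentiable_divide differentiable_add differentiable_diff differentiable_mult
        differentiable_const qd nz a)
  then show T: "(\<lambda>y. temperature (g y)) differentiable (at x)"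
    by (rule differentiable_eq_on_open[OF _ \<Omega> x]) (rule eqT[OF _ a])
  show u: "(\<lambda>y. velocity (g y)) differentiable (at x)"
  proof (rule differentiable_vec)
    fix k
    have "(\<lambda>y. temperature (g y) / 2 * (q (axis k 1) y - q (- axis k 1) y)) differentiable (at x)"
      by (intro differentiable_divide differentiable_diff differentiable_mult
        differentiable_const qd T) simp
    then show "(\<lambda>y. velocity (g y) $ k) differentiable (at x)"
      by (rule differentiable_eq_on_open[OF _ \<Omega> x]) (rule eqv)
  qed
  have "(\<lambda>y. g y 0 * exp (real CARD('m) / 2 * ln (2 * pi * temperature (g y))
      + velocity (g y) \<bullet> velocity (g y) / (2 * temperature (g y)))) differentiable (at x)"
    using pos(2)[OF x]
    by (intro differentiable_divide differentiable_add differentiable_mult differentiable_inner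
        differentiable_const differentiable_exp differentiable_ln T u diff) auto
  then show "(\<lambda>y. density (g y)) differentiable (at x)"
    by (rule differentiable_eq_on_open[OF _ \<Omega> x]) (rule eqd)
qed

text \<open>
  The bound on differences from the fixed point \<open>x\<close> that difference quotients at \<open>x\<close> ask for.
\<close>

lemma differentiable_imp_lipschitz_at:
  fixes f :: "'a::real_normed_vector \<Rightarrow> 'b::real_normed_vector"
  assumes "f differentiable (at x)"
  obtains L d where "L \<ge> 0" "d > 0" "\<And>y. norm (y - x) < d \<Longrightarrow> norm (f y - f x) \<le> L * norm (y - x)"
proof -
  obtain f' where f': "bounded_linear f'" and lim: "\<And>e. e > 0 \<Longrightarrow> \<exists>d>0. \<forall>y.
      norm (y - x) < d \<longrightarrow> norm (f y - f x - f' (y - x)) \<le> e * norm (y - x)"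
    using assms unfolding differentiable_def has_derivative_at_alt by blast
  obtain d where d: "d > 0"
    "\<And>y. norm (y - x) < d \<Longrightarrow> norm (f y - f x - f' (y - x)) \<le> 1 * norm (y - x)"
    using lim[of 1] by auto
  obtain K where K: "K \<ge> 0" "\<And>h. norm (f' h) \<le> norm h * K"
    using bounded_linear.nonneg_bounded[OF f'] by auto
  show ?thesis
  proof (rule that[of "1 + K" d])
    fix y assume y: "norm (y - x) < d"
    have "norm (f y - f x) \<le> norm (f y - f x - f' (y - x)) + norm (f' (y - x))"
      using norm_triangle_sub[of "f y - f x" "f' (y - x)"] by simp
    also have "\<dots> \<le> (1 + K) * norm (y - x)"
      using d(2)[OF y] K(2)[of "y - x"] by (simp add: algebra_simps)
    finally show "norm (f y - f x) \<le> (1 + K) * norm (y - x)" .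
  qed (use d K in auto)
qed

lemma abs_exp_diff_le:
  fixes a b m :: real
  assumes "a \<le> m" "b \<le> m"
  shows "\<bar>exp a - exp b\<bar> \<le> \<bar>a - b\<bar> * exp m"
proof -
  have *: "exp p - exp r \<le> (p - r) * exp m" if "r \<le> p" "p \<le> m" for p r :: real
  proof -
    have "exp p - exp r = exp p * (1 - exp (r - p))"
      by (simp add: exp_diff algebra_simps)
    also have "\<dots> \<le> exp p * (p - r)"
    proof (rule mult_left_mono)
      show "1 - exp (r - p) \<le> p - r"
        using exp_ge_add_one_self[of "r - p"] by linarith
    qed simp
    also have "\<dots> \<le> (p - r) * exp m"
      using that mult_right_mono[of "exp p" "exp m" "p - r"] by (simp add: mult.commute)
    finally show ?thesis .
  qed
  show ?thesis
    using *[of a b] *[of b a] assms by (cases "a \<le> b") auto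
qed

text \<open>
  The exponents at \<open>y\<close> and \<open>x\<close> differ by at most a constant times \<open>|y - x| (1 + |v|)\<^sup>2\<close>. For \<open>y\<close> close
  to \<open>x\<close> both exponents stay below one concave quadratic in \<open>|v|\<close>, because \<open>C y \<ge> C x / 2\<close>. The
  resulting bound is an integrable majorant for the difference quotients.
\<close>

lemma exp_quadratic_field_lipschitz:
  fixes A C :: "'a::real_normed_vector \<Rightarrow> real" and B :: "'a \<Rightarrow> 'b::real_inner"
  assumes "A differentiable (at x)" "B differentiable (at x)" "C differentiable (at x)" "C x > 0"
  obtains K b c d where "d > 0" "c > 0" "\<And>y v. norm (y - x) < d \<Longrightarrow>
    \<bar>exp (A y + B y \<bullet> v - C y * (norm v)\<^sup>2) - exp (A x + B x \<bullet> v - C x * (norm v)\<^sup>2)\<bar>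
      \<le> norm (y - x) * (K * ((1 + norm v)\<^sup>2 * exp (b * norm v - c * (norm v)\<^sup>2)))"
proof -
  obtain LA dA where A: "LA \<ge> 0" "dA > 0" "\<And>y. norm (y - x) < dA \<Longrightarrow> norm (A y - A x) \<le> LA * norm (y - x)"
    using differentiable_imp_lipschitz_at[OF assms(1)] by blast
  obtain LB dB where B: "LB \<ge> 0" "dB > 0" "\<And>y. norm (y - x) < dB \<Longrightarrow> norm (B y - B x) \<le> LB * norm (y - x)"
    using differentiable_imp_lipschitz_at[OF assms(2)] by blast
  obtain LC dC where C: "LC \<ge> 0" "dC > 0" "\<And>y. norm (y - x) < dC \<Longrightarrow> norm (C y - C x) \<le> LC * norm (y - x)"
    using differentiable_imp_lipschitz_at[OF assms(3)] by blast
  \<comment> \<open>The last entry keeps \<open>C y\<close> above \<open>C x / 2\<close>.\<close>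
  define d where "d = min (min dA dB) (min dC (min 1 (C x / (2 * (LC + 1)))))"
  define q where "q y v = A y + B y \<bullet> v - C y * (norm v)\<^sup>2" for y v
  define b where "b = norm (B x) + LB"
  define c where "c = C x / 2"
  define a where "a = \<bar>A x\<bar> + LA"
  have d: "d > 0"
    using A B C assms(4) by (simp add: d_def)
  have bound: "q y v \<le> a + (b * norm v - c * (norm v)\<^sup>2)" if y: "norm (y - x) < d" for y v
  proof -
    have y1: "norm (y - x) \<le> 1" and y2: "norm (y - x) \<le> C x / (2 * (LC + 1))"
      and yd: "norm (y - x) < dA" "norm (y - x) < dB" "norm (y - x) < dC"
      using y by (auto simp: d_def)
    have "norm (A y - A x) \<le> LA * 1"
      using A(3)[OF yd(1)] mult_left_mono[OF y1 A(1)] by linarith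
    then have a: "A y \<le> a" by (simp add: a_def)
    have "norm (B y - B x) \<le> LB * 1"
      using B(3)[OF yd(2)] mult_left_mono[OF y1 B(1)] by linarith
    then have "norm (B y) \<le> b"
      using norm_triangle_sub[of "B y" "B x"] by (simp add: b_def)
    then have b: "B y \<bullet> v \<le> b * norm v"
      using norm_cauchy_schwarz[of "B y" v] mult_right_mono[of "norm (B y)" b "norm v"] by simp
    have "norm (C y - C x) \<le> LC * (C x / (2 * (LC + 1)))"
      using C(3)[OF yd(3)] mult_left_mono[OF y2 C(1)] by linarith
    also have "\<dots> \<le> C x / 2"
      using C(1) assms(4) by (simp add: field_simps)
    finally have "c \<le> C y" unfolding c_def real_norm_def by linarith
    then have "c * (norm v)\<^sup>2 \<le> C y * (norm v)\<^sup>2"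
      by (intro mult_right_mono) auto
    with a b show ?thesis by (simp add: q_def)
  qed
  show ?thesis
  proof (rule that[of d c "(LA + LB + LC) * exp a" b])
    fix y :: 'a and v :: 'b
    assume y: "norm (y - x) < d"
    then have yd: "norm (y - x) < dA" "norm (y - x) < dB" "norm (y - x) < dC"
      by (auto simp: d_def)
    let ?n = "norm v" and ?h = "norm (y - x)"
    have "\<bar>q y v - q x v\<bar> = \<bar>(A y - A x) + (B y - B x) \<bullet> v - (C y - C x) * ?n\<^sup>2\<bar>"
      by (simp add: q_def inner_diff_left algebra_simps)
    also have "\<dots> \<le> \<bar>A y - A x\<bar> + \<bar>(B y - B x) \<bullet> v\<bar> + \<bar>C y - C x\<bar> * ?n\<^sup>2"
    proof -
      have "\<bar>C y - C x\<bar> * ?n\<^sup>2 = \<bar>(C y - C x) * ?n\<^sup>2\<bar>"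
        by (simp add: abs_mult)
      then show ?thesis by linarith
    qed
    also have "\<dots> \<le> LA * ?h + (LB * ?h) * ?n + (LC * ?h) * ?n\<^sup>2"
    proof -
      have "\<bar>(B y - B x) \<bullet> v\<bar> \<le> norm (B y - B x) * ?n"
        by (rule Cauchy_Schwarz_ineq2)
      also have "\<dots> \<le> (LB * ?h) * ?n"
        using B(3)[OF yd(2)] by (intro mult_right_mono) auto
      finally show ?thesis
        using A(3)[OF yd(1)] C(3)[OF yd(3)] by (intro add_mono mult_right_mono) auto
    qed
    also have "\<dots> = ?h * (LA * 1 + LB * ?n + LC * ?n\<^sup>2)"
      by (simp add: algebra_simps)
    also have "\<dots> \<le> ?h * (LA * (1 + ?n)\<^sup>2 + LB * (1 + ?n)\<^sup>2 + LC * (1 + ?n)\<^sup>2)"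
      using A(1) B(1) C(1)
      by (intro mult_left_mono add_mono) (auto simp: power2_eq_square algebra_simps)
    finally have lip: "\<bar>q y v - q x v\<bar> \<le> ?h * ((LA + LB + LC) * (1 + ?n)\<^sup>2)"
      by (simp add: algebra_simps)
    have "\<bar>exp (q y v) - exp (q x v)\<bar> \<le> \<bar>q y v - q x v\<bar> * exp (a + (b * ?n - c * ?n\<^sup>2))"
      using bound[OF y] bound[of x] d by (intro abs_exp_diff_le) auto
    also have "\<dots> \<le> ?h * ((LA + LB + LC) * (1 + ?n)\<^sup>2) * exp (a + (b * ?n - c * ?n\<^sup>2))"
      using lip by (intro mult_right_mono) auto
    also have "\<dots> = ?h * ((LA + LB + LC) * exp a * ((1 + ?n)\<^sup>2 * exp (b * ?n - c * ?n\<^sup>2)))"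
      by (simp add: exp_add)
    finally show "\<bar>exp (A y + B y \<bullet> v - C y * ?n\<^sup>2) - exp (A x + B x \<bullet> v - C x * ?n\<^sup>2)\<bar>
      \<le> ?h * ((LA + LB + LC) * exp a * ((1 + ?n)\<^sup>2 * exp (b * ?n - c * ?n\<^sup>2)))"
      by (simp add: q_def)
  qed (use d assms(4) in \<open>auto simp: c_def\<close>)
qed

lemma partial_tendsto:
  fixes f :: "real^'n::finite \<Rightarrow> 'b::real_normed_vector"
  assumes f: "f differentiable (at x)" and t: "t \<longlonglongrightarrow> 0" "\<And>n::nat. t n \<noteq> 0"
  shows "(\<lambda>n. (1 / t n) *\<^sub>R (f (x + t n *\<^sub>R axis k 1) - f x)) \<longlonglongrightarrow> partial k f x"
proof -
  let ?f' = "frechet_derivative f (at x)"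
  have f': "(f has_derivative ?f') (at x)"
    using f frechet_derivative_works by blast
  have "((\<lambda>s. f (x + s *\<^sub>R axis k 1)) has_derivative (\<lambda>s. ?f' (s *\<^sub>R axis k 1))) (at 0)"
    by (rule has_derivative_compose[of "\<lambda>s. x + s *\<^sub>R axis k 1", where g = f])
      (use f' in \<open>auto intro!: derivative_eq_intros\<close>)
  then have "((\<lambda>s. f (x + s *\<^sub>R axis k 1)) has_vector_derivative ?f' (axis k 1)) (at 0)"
    using linear_scale[OF has_derivative_linear[OF f']]
    by (simp add: has_vector_derivative_def)
  then have lim: "((\<lambda>s. norm (f (x + s *\<^sub>R axis k 1) - f x - s *\<^sub>R ?f' (axis k 1)) / norm s) \<longlongrightarrow> 0) (at 0)"
    by (simp add: has_vector_derivative_def has_derivative_at)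
  have "(\<lambda>n. norm (f (x + t n *\<^sub>R axis k 1) - f x - t n *\<^sub>R ?f' (axis k 1)) / norm (t n)) \<longlonglongrightarrow> 0"
    using lim t unfolding tendsto_at_iff_sequentially by (auto simp: comp_def)
  moreover have "norm (f (x + t n *\<^sub>R axis k 1) - f x - t n *\<^sub>R ?f' (axis k 1)) / norm (t n)
      = norm ((1 / t n) *\<^sub>R (f (x + t n *\<^sub>R axis k 1) - f x) - ?f' (axis k 1))" for n
  proof -
    have "(1 / t n) *\<^sub>R (f (x + t n *\<^sub>R axis k 1) - f x) - ?f' (axis k 1)
        = (1 / t n) *\<^sub>R (f (x + t n *\<^sub>R axis k 1) - f x - t n *\<^sub>R ?f' (axis k 1))"
      using t(2)[of n] by (simp add: scaleR_diff_right)
    then show ?thesis by (simp add: divide_inverse mult.commute)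
  qed
  ultimately show ?thesis
    unfolding partial_def by (simp only: tendsto_norm_zero_iff) (simp only: LIM_zero_iff)
qed

lemma maxwellian_profile_eq_exp_quadratic:
  fixes u v :: "real^'m::finite"
  assumes "\<rho> > 0" and "T > 0"
  shows "maxwellian_profile \<rho> u T v = exp ((ln \<rho> - real CARD('m) / 2 * ln (2 * pi * T) - u \<bullet> u / (2 * T))
           + (1 / T) *\<^sub>R u \<bullet> v - 1 / (2 * T) * (norm v)\<^sup>2)"
proof -
  have "maxwellian_profile \<rho> u T v = exp (ln (maxwellian_profile \<rho> u T v))"
    using assms by (simp add: maxwellian_profile_def)
  also have "ln (maxwellian_profile \<rho> u T v)
      = (ln \<rho> - real CARD('m) / 2 * ln (2 * pi * T) - u \<bullet> u / (2 * T))
        + (1 / T) *\<^sub>R u \<bullet> v - 1 / (2 * T) * (norm v)\<^sup>2"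
    using assms(2)
    by (simp add: ln_maxwellian_profile[OF assms] power2_norm_eq_inner inner_diff_left inner_diff_right
        inner_commute[of v u] add_divide_distrib diff_divide_distrib)
  finally show ?thesis .
qed

lemma norm_collision_invariants_le: "norm (collision_invariants (v::real^'m::finite)) \<le> (1 + norm v) ^ 2"
proof -
  have "norm (collision_invariants v) \<le> norm (1::real) + (norm v + norm ((norm v)\<^sup>2 / 2))"
    unfolding collision_invariants_def
    by (intro order_trans[OF norm_Pair_le] add_mono order_refl)
  also have "\<dots> \<le> (1 + norm v) ^ 2"
    by (simp add: power2_eq_square algebra_simps)
  finally show ?thesis .
qed

lemma collision_invariants_measurable [measurable]:
  "(collision_invariants :: real^'m::finite \<Rightarrow> _) \<in> borel_measurable borel"
  unfolding collision_invariants_def[abs_def] by measurable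

lemma maxwellian_measurable [measurable]: "maxwellian g \<in> borel_measurable borel"
  unfolding maxwellian_def[abs_def] by measurable

text \<open>
  The Euler flux of the moments is the integral of \<open>g y v\<close> against \<open>(v $ l) \<phi>(v)\<close>, and the claim is
  that \<open>\<partial>\<^sub>k\<close> may be taken under the integral. Writing the Maxwellian as the exponential of a quadratic
  polynomial in \<open>v\<close> with coefficients differentiable at \<open>x\<close> dominates the difference quotients in the
  direction \<open>k\<close>. Their integrals are difference quotients of the flux, which is differentiable by
  its formula in density, velocity and temperature.
\<close>

lemma partial_maxwellian_flux:
  fixes g :: "('n::finite, 'm::finite) kinetic"
  assumes \<Omega>: "open \<Omega>" and x: "x \<in> \<Omega>"
    and eq: "\<And>y. y \<in> \<Omega> \<Longrightarrow> maxwellian (g y) = g y"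
    and mom: "\<And>y. y \<in> \<Omega> \<Longrightarrow> has_moments (g y)"
    and pos: "\<And>y. y \<in> \<Omega> \<Longrightarrow> density (g y) > 0" "\<And>y. y \<in> \<Omega> \<Longrightarrow> temperature (g y) > 0"
    and diff: "\<And>v. (\<lambda>y. g y v) differentiable (at x)"
  shows "(\<lambda>y. moments (g y)) differentiable (at x)"
    and "has_bochner_integral lborel
           (\<lambda>v. partial k (\<lambda>y. g y v) x *\<^sub>R ((v $ l) *\<^sub>R collision_invariants v))
           (partial k (\<lambda>y. euler_flux l (moments (g y))) x)"
proof -
  let ?\<rho> = "\<lambda>y. density (g y)" and ?u = "\<lambda>y. velocity (g y)" and ?T = "\<lambda>y. temperature (g y)"
  let ?\<phi> = "\<lambda>v::real^'m. (v $ l) *\<^sub>R collision_invariants v"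
  note d = maxwellian_field_differentiable[of \<Omega> x g, OF \<Omega> x eq pos diff]
  have T0: "?T x \<noteq> 0"
    using pos(2)[OF x] by simp
  have norm_d: "(\<lambda>y. (norm (?u y))\<^sup>2) differentiable (at x)"
    unfolding power2_norm_eq_inner using d by (intro differentiable_inner)
  define flux where "flux y = ?\<rho> y *\<^sub>R (axis l 1 \<bullet> ?u y, (axis l 1 \<bullet> ?u y) *\<^sub>R ?u y + ?T y *\<^sub>R axis l 1,
    (axis l 1 \<bullet> ?u y) * ((norm (?u y))\<^sup>2 / 2 + ?T y + real CARD('m) / 2 * ?T y))" for y
  have "(\<lambda>y. (?\<rho> y, ?\<rho> y *\<^sub>R ?u y,
      real CARD('m) / 2 * ?\<rho> y * ?T y + ?\<rho> y * (norm (?u y))\<^sup>2 / 2)) differentiable (at x)"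
    by (intro differentiable_Pair differentiable_scaleR differentiable_add differentiable_mult
        differentiable_divide differentiable_const d norm_d) simp_all
  then show "(\<lambda>y. moments (g y)) differentiable (at x)"
    by (rule differentiable_eq_on_open[OF _ \<Omega> x]) (rule moments_eq[symmetric, OF mom pos(1)])
  have flux_eq: "euler_flux l (moments (g y)) = flux y" if "y \<in> \<Omega>" for y
    using euler_flux_eq_maxwellian_flux[of "?\<rho> y" l "?u y" "?T y"] pos(1)[OF that]
    by (simp add: moments_eq[OF mom[OF that] pos(1)[OF that]] flux_def inner_axis' del: euler_flux.simps)
  have "flux differentiable (at x)"
    unfolding flux_def[abs_def]
    by (intro differentiable_Pair differentiable_scaleR differentiable_add differentiable_mult
        differentiable_divide differentiable_const differentiable_inner d norm_d) simp_all
  then have flux_d: "(\<lambda>y. euler_flux l (moments (g y))) differentiable (at x)"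
    by (rule differentiable_eq_on_open[OF _ \<Omega> x]) (rule flux_eq[symmetric])
  have flux_int: "has_bochner_integral lborel (\<lambda>v. g y v *\<^sub>R ?\<phi> v) (euler_flux l (moments (g y)))"
    if "y \<in> \<Omega>" for y
  proof -
    have "g y = maxwellian_profile (?\<rho> y) (?u y) (?T y)"
      using eq[OF that] by (simp add: maxwellian_eq_profile)
    then show ?thesis
      using maxwellian_profile_flux[OF pos(2)[OF that], of "?\<rho> y" "?u y" "axis l 1"]
      by (simp add: flux_eq[OF that] flux_def inner_axis' del: scaleR_Pair)
  qed
  define A where "A y = ln (?\<rho> y) - real CARD('m) / 2 * ln (2 * pi * ?T y) - ?u y \<bullet> ?u y / (2 * ?T y)" for y
  define B where "B y = (1 / ?T y) *\<^sub>R ?u y" for y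
  define C where "C y = 1 / (2 * ?T y)" for y
  have g_exp: "g y v = exp (A y + B y \<bullet> v - C y * (norm v)\<^sup>2)" if "y \<in> \<Omega>" for y v
    using maxwellian_profile_eq_exp_quadratic[OF pos[OF that], of "?u y" v]
    unfolding A_def B_def C_def by (simp only: maxwellian_eq_profile[symmetric] eq[OF that])
  have dA: "A differentiable (at x)"
    unfolding A_def[abs_def] using pos[OF x]
    by (intro differentiable_diff differentiable_divide differentiable_mult differentiable_inner
        differentiable_const differentiable_ln d) auto
  have dB: "B differentiable (at x)"
    unfolding B_def[abs_def]
    by (intro differentiable_scaleR differentiable_divide differentiable_const d T0)
  have dC: "C differentiable (at x)"
    unfolding C_def[abs_def] using T0
    by (intro differentiable_divide differentiable_mult differentiable_const d) simp_all
  have C0: "C x > 0"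
    using pos(2)[OF x] by (simp add: C_def)
  obtain K b c r where r: "r > 0" and c: "c > 0" and lip: "\<And>y v. norm (y - x) < r \<Longrightarrow>
    \<bar>exp (A y + B y \<bullet> v - C y * (norm v)\<^sup>2) - exp (A x + B x \<bullet> v - C x * (norm v)\<^sup>2)\<bar>
      \<le> norm (y - x) * (K * ((1 + norm v)\<^sup>2 * exp (b * norm v - c * (norm v)\<^sup>2)))"
    by (rule exp_quadratic_field_lipschitz[OF dA dB dC C0]) blast
  obtain r' where r': "r' > 0" "ball x r' \<subseteq> \<Omega>"
    using \<Omega> x open_contains_ball by blast
  \<comment> \<open>Dividing by at least 2 keeps every step strictly inside both balls.\<close>
  define t where "t n = min r r' / real (n + 2)" for n
  have t_pos: "t n > 0" for n
    using r r' by (simp add: t_def)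
  have t_less: "t n < r" "t n < r'" for n
  proof -
    have "t n < min r r'"
      using r r'(1) by (simp add: t_def divide_less_eq mult_less_cancel_left1 del: min_less_iff_conj)
    then show "t n < r" "t n < r'" by auto
  qed
  have t_lim: "t \<longlonglongrightarrow> 0"
    unfolding t_def by (rule LIMSEQ_ignore_initial_segment[of "\<lambda>n. min r r' / real n" 0 2]) (rule lim_const_over_n)
  let ?e = "axis k 1 :: real^'n"
  have y_in: "x + t n *\<^sub>R ?e \<in> \<Omega>" for n
    using r'(2) t_less(2)[of n] t_pos[of n] by (auto simp: dist_norm subset_iff)
  define s where "s n v = ((1 / t n) *\<^sub>R (g (x + t n *\<^sub>R ?e) v - g x v)) *\<^sub>R ?\<phi> v" for n v
  define w where "w v = K * ((1 + norm v) ^ 5 * exp (b * norm v - c * (norm v)\<^sup>2))" for v :: "real^'m"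
  have g_meas: "g y \<in> borel_measurable borel" if "y \<in> \<Omega>" for y
    using maxwellian_measurable[of "g y"] by (simp add: eq[OF that])
  have s_meas: "s n \<in> borel_measurable lborel" for n
    using g_meas[OF y_in[of n]] g_meas[OF x] unfolding s_def[abs_def] by measurable
  have s_lim: "(\<lambda>n. s n v) \<longlonglongrightarrow> partial k (\<lambda>y. g y v) x *\<^sub>R ?\<phi> v" for v
    unfolding s_def using t_pos
    by (intro tendsto_scaleR tendsto_const partial_tendsto[OF diff t_lim]) (auto simp: less_imp_neq[THEN not_sym])
  have lim_meas: "(\<lambda>v. partial k (\<lambda>y. g y v) x *\<^sub>R ?\<phi> v) \<in> borel_measurable lborel"
    by (rule borel_measurable_LIMSEQ_metric[OF s_meas s_lim])
  have w_int: "integrable lborel w"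
    unfolding w_def by (intro integrable_mult_right integrable_polynomial_gaussian c)
  have s_bound: "norm (s n v) \<le> w v" for n v
  proof -
    have "norm (?\<phi> v) \<le> (1 + norm v) * (1 + norm v) ^ 2"
      using component_le_norm_cart[of v l] norm_collision_invariants_le[of v]
      unfolding norm_scaleR by (intro mult_mono) auto
    then have \<phi>: "norm (?\<phi> v) \<le> (1 + norm v) ^ 3"
      by (simp add: power2_eq_square power3_eq_cube)
    have "\<bar>g (x + t n *\<^sub>R ?e) v - g x v\<bar>
        \<le> t n * (K * ((1 + norm v)\<^sup>2 * exp (b * norm v - c * (norm v)\<^sup>2)))"
      using lip[of "x + t n *\<^sub>R ?e" v] t_less(1)[of n] t_pos[of n]
      unfolding g_exp[OF y_in] g_exp[OF x] by simp
    then have quot: "\<bar>(1 / t n) *\<^sub>R (g (x + t n *\<^sub>R ?e) v - g x v)\<bar>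
        \<le> K * ((1 + norm v)\<^sup>2 * exp (b * norm v - c * (norm v)\<^sup>2))"
      using t_pos[of n] by (simp add: abs_mult divide_le_eq mult.commute)
    have "norm (s n v) \<le> (K * ((1 + norm v)\<^sup>2 * exp (b * norm v - c * (norm v)\<^sup>2))) * (1 + norm v) ^ 3"
      unfolding s_def norm_scaleR[of _ "?\<phi> v"]
      by (rule mult_mono[OF quot \<phi> order_trans[OF abs_ge_zero quot] norm_ge_zero])
    also have "\<dots> = K * (((1 + norm v)\<^sup>2 * (1 + norm v) ^ 3) * exp (b * norm v - c * (norm v)\<^sup>2))"
      by (simp only: mult_ac)
    also have "(1 + norm v)\<^sup>2 * (1 + norm v) ^ 3 = (1 + norm v) ^ 5"
      by (simp flip: power_add)
    also have "K * ((1 + norm v) ^ 5 * exp (b * norm v - c * (norm v)\<^sup>2)) = w v"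
      by (simp only: w_def)
    finally show ?thesis .
  qed
  note dct = lim_meas s_meas w_int AE_I2[OF s_lim] AE_I2[OF s_bound]
  have lim1: "(\<lambda>n. integral\<^sup>L lborel (s n)) \<longlonglongrightarrow> (\<integral>v. partial k (\<lambda>y. g y v) x *\<^sub>R ?\<phi> v \<partial>lborel)"
    by (rule integral_dominated_convergence[OF dct])
  have s_integral: "integral\<^sup>L lborel (s n)
      = (1 / t n) *\<^sub>R (euler_flux l (moments (g (x + t n *\<^sub>R ?e))) - euler_flux l (moments (g x)))" for n
  proof -
    have scaled: "has_bochner_integral lborel
        (\<lambda>v. (1 / t n) *\<^sub>R (g (x + t n *\<^sub>R ?e) v *\<^sub>R ?\<phi> v - g x v *\<^sub>R ?\<phi> v))
        ((1 / t n) *\<^sub>R (euler_flux l (moments (g (x + t n *\<^sub>R ?e))) - euler_flux l (moments (g x))))"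
      by (intro has_bochner_integral_scaleR_right has_bochner_integral_diff flux_int y_in x)
    have s_eq: "(\<lambda>v. (1 / t n) *\<^sub>R (g (x + t n *\<^sub>R ?e) v *\<^sub>R ?\<phi> v - g x v *\<^sub>R ?\<phi> v)) = s n"
      by (rule ext) (simp only: s_def real_scaleR_def scaleR_scaleR[symmetric] scaleR_diff_left)
    show ?thesis
      by (rule has_bochner_integral_integral_eq[OF scaled[unfolded s_eq]])
  qed
  have lim2: "(\<lambda>n. integral\<^sup>L lborel (s n)) \<longlonglongrightarrow> partial k (\<lambda>y. euler_flux l (moments (g y))) x"
    unfolding s_integral using t_pos
    by (intro partial_tendsto[OF flux_d t_lim]) (auto simp: less_imp_neq[THEN not_sym])
  show "has_bochner_integral lborel (\<lambda>v. partial k (\<lambda>y. g y v) x *\<^sub>R ?\<phi> v)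
      (partial k (\<lambda>y. euler_flux l (moments (g y))) x)"
    using integrable_dominated_convergence[OF dct] LIMSEQ_unique[OF lim1 lim2]
    by (simp add: has_bochner_integral_iff)
qed

text \<open>
  The direction \<open>k\<close> is transported by the velocity component \<open>emb k\<close>, and this weight selects the
  column \<open>emb k\<close> of the Euler flux.
\<close>

lemma transport_moments_eq_euler_divergence:
  fixes emb :: "'n::finite \<Rightarrow> 'm::finite" and g :: "('n, 'm) kinetic"
  assumes \<Omega>: "open \<Omega>" and adm: "admissible_kinetic emb \<Omega> g"
    and eq: "\<And>y. y \<in> \<Omega> \<Longrightarrow> maxwellian (g y) = g y" and x: "x \<in> \<Omega>"
  shows "moments (transport emb g x) = euler_divergence emb (\<lambda>y. moments (g y)) x"
proof (rule moments_eqI)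
  have "has_bochner_integral lborel
      (\<lambda>v. \<Sum>k\<in>UNIV. partial k (\<lambda>y. g y v) x *\<^sub>R ((v $ emb k) *\<^sub>R collision_invariants v))
      (\<Sum>k\<in>UNIV. partial k (\<lambda>y. euler_flux (emb k) (moments (g y))) x)"
    by (intro has_bochner_integral_sum partial_maxwellian_flux(2)[OF \<Omega> x eq])
      (use adm x in \<open>auto simp: admissible_kinetic_def\<close>)
  then show "has_bochner_integral lborel (\<lambda>v. transport emb g x v *\<^sub>R collision_invariants v)
      (euler_divergence emb (\<lambda>y. moments (g y)) x)"
    by (simp add: transport_def euler_divergence_def scaleR_sum_left mult.commute)
qed

lemma moments_admissible_euler:
  fixes emb :: "'n::finite \<Rightarrow> 'm::finite" and g :: "('n, 'm) kinetic"
  assumes \<Omega>: "open \<Omega>" and adm: "admissible_kinetic emb \<Omega> g"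
    and eq: "\<And>y. y \<in> \<Omega> \<Longrightarrow> maxwellian (g y) = g y"
  shows "admissible_euler \<Omega> (\<lambda>x. moments (g x))"
  unfolding admissible_euler_def
proof (intro ballI conjI)
  fix x assume x: "x \<in> \<Omega>"
  have h: "has_moments (g x)" "density (g x) > 0" "temperature (g x) > 0"
    using adm x by (auto simp: admissible_kinetic_def)
  show "(\<lambda>x. moments (g x)) differentiable (at x)"
    by (rule partial_maxwellian_flux(1)[OF \<Omega> x eq])
      (use adm x in \<open>auto simp: admissible_kinetic_def\<close>)
  show "fst (moments (g x)) > 0" "euler_temperature (moments (g x)) > 0"
    using h by (simp_all add: euler_variables_of_moments)
qed

section \<open>The limit scheme\<close>

theorem proposition3p3:
  fixes emb :: "'n::finite \<Rightarrow> 'm::finite"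
    and \<Omega> :: "(real^'n) set"
    and \<tau> :: "real \<Rightarrow> real \<Rightarrow> real"
    and \<nu> :: nat
    and aE aI :: "nat \<Rightarrow> nat \<Rightarrow> real"
    and wE wI :: "nat \<Rightarrow> real"
    and \<alpha> \<Delta>t :: real
    and fn fn1 fstar :: "real \<Rightarrow> ('n, 'm) kinetic"
    and f :: "real \<Rightarrow> nat \<Rightarrow> ('n, 'm) kinetic"
    and gn gn1 :: "('n, 'm) kinetic"
    and g :: "nat \<Rightarrow> ('n, 'm) kinetic"
  assumes "inj emb" and "open \<Omega>" and "\<Delta>t > 0" and "\<alpha> \<ge> 0"
    and tau_pos: "\<And>\<rho> T. \<rho> > 0 \<Longrightarrow> T > 0 \<Longrightarrow> \<tau> \<rho> T > 0"
    and tau_cont: "continuous_on ({0<..} \<times> {0<..}) (\<lambda>(\<rho>, T). \<tau> \<rho> T)"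
    and coeffs: "imex_coefficients \<nu> aE aI"
    and type_A: "type_A \<nu> aI"
    and GSA: "GSA \<nu> aE aI wE wI"
    and order: "imex_order_two \<nu> aE aI wE wI \<alpha>"
    and fstar: "fstar = fn \<or> (\<exists>i\<in>{1..\<nu>}. fstar = (\<lambda>\<epsilon>. f \<epsilon> i)) \<or> fstar = fn1"
    and scheme: "\<And>\<epsilon>. \<epsilon> > 0 \<Longrightarrow>
        imex_step emb \<Omega> \<tau> \<nu> aE aI \<alpha> \<Delta>t \<epsilon> (fn \<epsilon>) (f \<epsilon>) (fstar \<epsilon>) (fn1 \<epsilon>)"
    and adm: "\<And>\<epsilon>. \<epsilon> > 0 \<Longrightarrow> admissible_kinetic emb \<Omega> (fn \<epsilon>)"
      "\<And>\<epsilon> i. \<epsilon> > 0 \<Longrightarrow> i \<in> {1..\<nu>} \<Longrightarrow> admissible_kinetic emb \<Omega> (f \<epsilon> i)"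
      "\<And>\<epsilon>. \<epsilon> > 0 \<Longrightarrow> admissible_kinetic emb \<Omega> (fn1 \<epsilon>)"
    and conv: "kinetic_converges emb \<Omega> fn gn"
      "\<And>i. i \<in> {1..\<nu>} \<Longrightarrow> kinetic_converges emb \<Omega> (\<lambda>\<epsilon>. f \<epsilon> i) (g i)"
      "kinetic_converges emb \<Omega> fn1 gn1"
    and adm_lim: "admissible_kinetic emb \<Omega> gn"
      "\<And>i. i \<in> {1..\<nu>} \<Longrightarrow> admissible_kinetic emb \<Omega> (g i)"
      "admissible_kinetic emb \<Omega> gn1"
  shows "explicit_tableau \<nu> aE \<and> rk_order_two \<nu> aE wE \<and>
    euler_rk_step emb \<Omega> \<nu> aE wE \<Delta>t (\<lambda>x. moments (gn x)) (\<lambda>x. moments (gn1 x))"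
proof (intro conjI)
  have aE0: "aE i j = 0" if "i \<in> {1..\<nu>}" "j \<in> {1..\<nu>}" "i \<le> j" for i j
    using coeffs that by (auto simp: imex_coefficients_def)
  then show "explicit_tableau \<nu> aE"
    by (simp add: explicit_tableau_def)
  have row_sum: "(\<Sum>j\<in>{1..<i}. aE i j) = (\<Sum>j\<in>{1..\<nu>}. aE i j)" if "i \<in> {1..\<nu>}" for i
    using that aE0 by (intro sum.mono_neutral_left) auto
  have "(\<Sum>i\<in>{1..\<nu>}. wE i * (\<Sum>j\<in>{1..\<nu>}. aE i j)) = (\<Sum>i\<in>{1..\<nu>}. wE i * (\<Sum>j\<in>{1..<i}. aE i j))"
    by (intro sum.cong refl) (simp only: row_sum)
  then show "rk_order_two \<nu> aE wE"
    using order by (simp add: rk_order_two_def imex_order_two_def Let_def)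
  \<comment> \<open>Without stages the weights would sum to 0 instead of 1.\<close>
  have "\<nu> \<noteq> 0"
    using order by (intro notI) (simp add: imex_order_two_def)
  then have \<nu>: "\<nu> \<in> {1..\<nu>}" by simp
  have eq: "maxwellian (g i y) = g i y" if "i \<in> {1..\<nu>}" "y \<in> \<Omega>" for i y
    by (rule stages_relax_to_maxwellian[OF \<open>\<Delta>t > 0\<close> tau_pos tau_cont coeffs type_A scheme adm(2)
          conv(1,2) adm_lim(2) that])
  have stage: "moments (g i x) = moments (gn x)
      - \<Delta>t *\<^sub>R (\<Sum>j\<in>{1..\<nu>}. aE i j *\<^sub>R euler_divergence emb (\<lambda>y. moments (g j y)) x)"
    if i: "i \<in> {1..\<nu>}" and x: "x \<in> \<Omega>" for i x
  proof -
    have "((\<lambda>\<epsilon>. moments (fn \<epsilon> x)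
            - \<Delta>t *\<^sub>R (\<Sum>j\<in>{1..<i}. aE i j *\<^sub>R moments (transport emb (f \<epsilon> j) x))) \<longlongrightarrow>
          moments (gn x) - \<Delta>t *\<^sub>R (\<Sum>j\<in>{1..<i}. aE i j *\<^sub>R moments (transport emb (g j) x)))
        (at_right 0)"
      using conv(1,2) i x
      by (intro tendsto_diff tendsto_scaleR tendsto_sum tendsto_const)
        (auto simp: kinetic_converges_def)
    moreover have "\<forall>\<^sub>F \<epsilon> in at_right 0. moments (fn \<epsilon> x)
            - \<Delta>t *\<^sub>R (\<Sum>j\<in>{1..<i}. aE i j *\<^sub>R moments (transport emb (f \<epsilon> j) x)) = moments (f \<epsilon> i x)"
      using eventually_at_right_less[of "0::real"]
      by eventually_elim (rule imex_step_moments[OF scheme adm(1,2) i x, symmetric])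
    ultimately have "((\<lambda>\<epsilon>. moments (f \<epsilon> i x)) \<longlongrightarrow>
          moments (gn x) - \<Delta>t *\<^sub>R (\<Sum>j\<in>{1..<i}. aE i j *\<^sub>R moments (transport emb (g j) x)))
        (at_right 0)"
      by (rule Lim_transform_eventually)
    moreover have "((\<lambda>\<epsilon>. moments (f \<epsilon> i x)) \<longlongrightarrow> moments (g i x)) (at_right 0)"
      using conv(2)[OF i] x by (simp add: kinetic_converges_def)
    ultimately have "moments (g i x)
        = moments (gn x) - \<Delta>t *\<^sub>R (\<Sum>j\<in>{1..<i}. aE i j *\<^sub>R moments (transport emb (g j) x))"
      by (rule tendsto_unique[OF trivial_limit_at_right_real, rotated])
    also have "(\<Sum>j\<in>{1..<i}. aE i j *\<^sub>R moments (transport emb (g j) x))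
        = (\<Sum>j\<in>{1..<i}. aE i j *\<^sub>R euler_divergence emb (\<lambda>y. moments (g j y)) x)"
      using i x
      by (intro sum.cong refl arg_cong2[where f = scaleR]
          transport_moments_eq_euler_divergence[OF \<open>open \<Omega>\<close>] adm_lim(2) eq) auto
    also have "\<dots> = (\<Sum>j\<in>{1..\<nu>}. aE i j *\<^sub>R euler_divergence emb (\<lambda>y. moments (g j y)) x)"
      using i aE0 by (intro sum.mono_neutral_left) auto
    finally show ?thesis .
  qed
  have final: "moments (gn1 x) = moments (g \<nu> x)" if x: "x \<in> \<Omega>" for x
  proof (rule tendsto_unique[OF trivial_limit_at_right_real])
    show "((\<lambda>\<epsilon>. moments (fn1 \<epsilon> x)) \<longlongrightarrow> moments (gn1 x)) (at_right 0)"
      using conv(3) x by (simp add: kinetic_converges_def)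
    have "\<forall>\<^sub>F \<epsilon> in at_right 0. moments (f \<epsilon> \<nu> x) = moments (fn1 \<epsilon> x)"
      using eventually_at_right_less[of "0::real"]
      by eventually_elim (rule imex_final_moments[OF scheme adm(2)[OF _ \<nu>] adm(3) x, symmetric])
    then show "((\<lambda>\<epsilon>. moments (fn1 \<epsilon> x)) \<longlongrightarrow> moments (g \<nu> x)) (at_right 0)"
      using conv(2)[OF \<nu>] x
      by (auto simp: kinetic_converges_def intro: Lim_transform_eventually)
  qed
  \<comment> \<open>The Runge-Kutta stages are the moments of the limiting kinetic stages.\<close>
  show "euler_rk_step emb \<Omega> \<nu> aE wE \<Delta>t (\<lambda>x. moments (gn x)) (\<lambda>x. moments (gn1 x))"
    unfolding euler_rk_step_def
  proof (intro exI[of _ "\<lambda>i x. moments (g i x)"] conjI ballI)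
    fix i assume i: "i \<in> {1..\<nu>}"
    show "admissible_euler \<Omega> (\<lambda>x. moments (g i x))"
      by (rule moments_admissible_euler[OF \<open>open \<Omega>\<close> adm_lim(2)[OF i] eq[OF i]])
  next
    fix i x assume "i \<in> {1..\<nu>}" "x \<in> \<Omega>"
    then show "moments (g i x) = moments (gn x)
        - \<Delta>t *\<^sub>R (\<Sum>j\<in>{1..\<nu>}. aE i j *\<^sub>R euler_divergence emb (\<lambda>x. moments (g j x)) x)"
      by (rule stage)
  next
    fix x assume x: "x \<in> \<Omega>"
    have "(\<Sum>j\<in>{1..\<nu>}. aE \<nu> j *\<^sub>R euler_divergence emb (\<lambda>y. moments (g j y)) x)
        = (\<Sum>i\<in>{1..\<nu>}. wE i *\<^sub>R euler_divergence emb (\<lambda>y. moments (g i y)) x)"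
      using GSA by (intro sum.cong refl) (simp add: GSA_def)
    then show "moments (gn1 x) = moments (gn x)
        - \<Delta>t *\<^sub>R (\<Sum>i\<in>{1..\<nu>}. wE i *\<^sub>R euler_divergence emb (\<lambda>x. moments (g i x)) x)"
      using final[OF x] stage[OF \<nu> x] by simp
  qed
qed

end
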